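(* Let $p,q$ be natural numbers with $p+q=n$, and let $|\tau\rangle\in(\mathbb C^d)^{\otimes n}$ be a unit vector lying in $\operatorname{span}\{P_\pi(|0\rangle^{\otimes p}\otimes|1\rangle^{\otimes q}):\pi\in S_n\}$ and in the symmetric subspace of $(\mathbb C^d)^{\otimes n}$. Perform on $|\tau\rangle$ the symmetric joint measurement with outcome $\psi$, and let $\Psi=(d+n)\psi$. Let $O\in\mathbb C^{d\times d}$ be a Hermitian observable with $\operatorname{Tr}(O)=0$. Then $$\begin{aligned}\operatorname{Var}[\operatorname{Tr}(O\Psi)]={}&\frac{n+d}{n+d+1}\Big(\operatorname{Tr}(O^2)+2p\langle0|O^2|0\rangle+2q\langle1|O^2|1\rangle+2pq\,(\langle0|O|1\rangle)^2\Big)\\&-\frac1{n+d+1}\Big(p^2(\langle0|O|0\rangle)^2+q^2(\langle1|O|1\rangle)^2+2pq\,\langle0|O|0\rangle\,\langle1|O|1\rangle\Big).\end{aligned}$$ Moreover, whenever $O$ has the form $\begin{bmatrix}1&1&\cdots\\1&-1&\cdots\\\vdots&\vdots&\ddots\end{bmatrix}$ (that is, $\langle0|O|0\rangle=\langle0|O|1\rangle=\langle1|O|0\rangle=1$ and $\langle1|O|1\rangle=-1$) and $p,q=\Theta(n)$, one has, for all sufficiently large $n$, $$\frac1{n^2}\operatorname{Var}[\operatorname{Tr}(O\Psi)]\ \ge\ \Omega\Big(\frac{pq}{n^2}\,(\langle0|O|1\rangle)^2\Big)\ \ge\ \Omega(1).$$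
   Context: $|0\rangle,|1\rangle$ are the first two standard basis vectors of $\mathbb C^d$ ($d\ge2$). $P_\pi$ ($\pi\in S_n$) permutes the tensor factors of $(\mathbb C^d)^{\otimes n}$. The symmetric joint measurement (the row symmetric measurement for the one-part partition $\lambda=(n)$) is the POVM with elements $\kappa_n\psi^{\otimes n}$ with respect to the Haar (unitarily invariant) probability measure on rank-one projectors $\psi\in\mathbb C^{d\times d}$, $\kappa_n=\binom{n+d-1}{d-1}$, together with the "fail" element $I-\frac1{n!}\sum_{\pi\in S_n}P_\pi$ (which has probability $0$ on $|\tau\rangle$). The variance is over the measurement outcome. The vector $|\tau\rangle$ is, up to phase, the normalized uniform superposition of all distinct permutations of $|0\rangle^{\otimes p}\otimes|1\rangle^{\otimes q}$.
   Formalization: The printed variance is false (d=2, n=p=1, q=0, O=diag(1,-1): Var=2, formula 11/4); the formal right side also subtracts (n+d)/(n+d+1)·(p⟨0|O|0⟩²+q⟨1|O|1⟩²), and (⟨0|O|1⟩)² is read as |⟨0|O|1⟩|². *)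

theory Defs
  imports
    "HOL-Probability.Probability"
    "HOL-Combinatorics.Combinatorics"
    "HOL-Library.Function_Algebras"
    "HOL-Library.Landau_Symbols"
begin

definition ctranspose :: "complex^'n^'m \<Rightarrow> complex^'m^'n" where
  "ctranspose A = (\<chi> i j. cnj (A $ j $ i))"

definition hermitian :: "complex^'d^'d \<Rightarrow> bool" where
  "hermitian A \<longleftrightarrow> ctranspose A = A"

definition unitary :: "complex^'d^'d \<Rightarrow> bool" where
  "unitary U \<longleftrightarrow> ctranspose U ** U = mat 1 \<and> U ** ctranspose U = mat 1"

definition rank_one_projectors :: "(complex^'d^'d) set" where
  "rank_one_projectors = {\<psi>. hermitian \<psi> \<and> \<psi> ** \<psi> = \<psi> \<and> rank \<psi> = 1}"

definition haar_projector_measure :: "(complex^'d^'d) measure \<Rightarrow> bool" where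
  "haar_projector_measure H \<longleftrightarrow>
     prob_space H \<and>
     space H = rank_one_projectors \<and>
     sets H = sets (restrict_space borel rank_one_projectors) \<and>
     (\<forall>U. unitary U \<longrightarrow> distr H H (\<lambda>\<psi>. U ** \<psi> ** ctranspose U) = H)"


text \<open>The \<open>n\<close>-fold tensor power of \<open>complex^'d\<close>, for a number \<open>n\<close> that varies inside statements, is the
  space of functions on \<open>'d list\<close> vanishing outside the lists of length \<open>n\<close>: the value at
  \<open>[i\<^sub>1, \<dots>, i\<^sub>n]\<close> is the coordinate along the tensor product of the basis vectors with
  indices \<open>i\<^sub>1, \<dots>, i\<^sub>n\<close>.\<close>

type_synonym 'd tensor = "'d list \<Rightarrow> complex"

definition tensor_space :: "nat \<Rightarrow> 'd tensor set" where
  "tensor_space n = {v. \<forall>xs. length xs \<noteq> n \<longrightarrow> v xs = 0}"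

definition tscale :: "complex \<Rightarrow> 'd tensor \<Rightarrow> 'd tensor" where
  "tscale c v = (\<lambda>xs. c * v xs)"

global_interpretation tensor: vector_space tscale
  by standard (auto simp: tscale_def fun_eq_iff algebra_simps)

definition tinner :: "nat \<Rightarrow> 'd::finite tensor \<Rightarrow> 'd tensor \<Rightarrow> complex" where
  "tinner n u v = (\<Sum>xs | length xs = n. cnj (u xs) * v xs)"

definition pure_tensor :: "(complex^'d) list \<Rightarrow> 'd tensor" where
  "pure_tensor vs = (\<lambda>xs. if length xs = length vs then \<Prod>i<length vs. vs ! i $ xs ! i else 0)"

text \<open>The entry of the tensor power of \<open>A\<close> in row \<open>xs\<close> and column \<open>ys\<close> is the product of the entries
  \<open>A $ xs ! i $ ys ! i\<close>.\<close>

definition tensor_power :: "nat \<Rightarrow> complex^'d^'d \<Rightarrow> 'd tensor \<Rightarrow> 'd tensor" where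
  "tensor_power n A v = (\<lambda>xs. if length xs = n
     then \<Sum>ys | length ys = n. (\<Prod>i<n. A $ xs ! i $ ys ! i) * v ys else 0)"

text \<open>\<open>perm_op n \<pi>\<close> moves the tensor factor at position \<open>j\<close> to position \<open>\<pi> j\<close>.\<close>

definition perm_op :: "nat \<Rightarrow> (nat \<Rightarrow> nat) \<Rightarrow> 'd tensor \<Rightarrow> 'd tensor" where
  "perm_op n \<pi> v = (\<lambda>xs. if length xs = n then v (permute_list \<pi> xs) else 0)"

definition symmetric_subspace :: "nat \<Rightarrow> 'd tensor set" where
  "symmetric_subspace n =
     {v \<in> tensor_space n. \<forall>\<pi>. \<pi> permutes {..<n} \<longrightarrow> perm_op n \<pi> v = v}"

definition valid_state :: "'d::finite \<Rightarrow> 'd \<Rightarrow> nat \<Rightarrow> nat \<Rightarrow> nat \<Rightarrow> 'd tensor \<Rightarrow> bool" where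
  "valid_state i0 i1 n p q \<tau> \<longleftrightarrow>
     tinner n \<tau> \<tau> = 1 \<and>
     \<tau> \<in> tensor.span {perm_op n \<pi> (pure_tensor (replicate p (axis i0 1) @ replicate q (axis i1 1))) | \<pi>.
       \<pi> permutes {..<n}} \<and>
     \<tau> \<in> symmetric_subspace n"

definition sym_effect :: "nat \<Rightarrow> complex^'d^'d \<Rightarrow> 'd tensor \<Rightarrow> 'd tensor" where
  "sym_effect n \<psi> v =
     tscale (of_nat ((n + CARD('d) - 1) choose (CARD('d) - 1))) (tensor_power n \<psi> v)"

definition fail_effect :: "nat \<Rightarrow> 'd tensor \<Rightarrow> 'd tensor" where
  "fail_effect n v = v - tscale (1 / fact n) (\<Sum>\<pi> | \<pi> permutes {..<n}. perm_op n \<pi> v)"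

definition born :: "nat \<Rightarrow> 'd::finite tensor \<Rightarrow> ('d tensor \<Rightarrow> 'd tensor) \<Rightarrow> real" where
  "born n \<tau> E = Re (tinner n \<tau> (E \<tau>))"

text \<open>The law of the outcome \<open>\<psi>\<close> is taken on the rank-one projectors only. This loses nothing on
  symmetric states, where the fail outcome has probability zero.\<close>

definition sym_outcome ::
    "(complex^'d^'d) measure \<Rightarrow> nat \<Rightarrow> 'd::finite tensor \<Rightarrow> (complex^'d^'d) measure" where
  "sym_outcome H n \<tau> = density H (\<lambda>\<psi>. ennreal (born n \<tau> (sym_effect n \<psi>)))"

lemma born_fail_effect:
  assumes "\<tau> \<in> symmetric_subspace n"
  shows "born n \<tau> (fail_effect n) = 0"
proof -
  have "(\<Sum>\<pi> | \<pi> permutes {..<n}. perm_op n \<pi> \<tau>) = (\<Sum>\<pi> | \<pi> permutes {..<n}. \<tau>)"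
    using assms by (intro sum.cong) (auto simp: symmetric_subspace_def)
  also have "\<dots> = tscale (fact n) \<tau>"
  proof -
    have "card {\<pi>. \<pi> permutes {..<n}} = fact n"
      by (simp add: card_permutations)
    moreover have "(\<Sum>\<pi>\<in>S. \<tau>) = tscale (of_nat (card S)) \<tau>" for S :: "(nat \<Rightarrow> nat) set"
      using tensor.sum_constant_scale[of \<tau> S] by simp
    ultimately show ?thesis by (simp del: sum_constant)
  qed
  finally have "fail_effect n \<tau> = 0"
    by (simp add: fail_effect_def tscale_def fun_eq_iff)
  then show ?thesis
    by (simp add: born_def tinner_def)
qed

definition outcome_variance ::
    "(complex^'d^'d) measure \<Rightarrow> nat \<Rightarrow> 'd::finite tensor \<Rightarrow> complex^'d^'d \<Rightarrow> real" where
  "outcome_variance H n \<tau> A =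
     prob_space.variance (sym_outcome H n \<tau>)
       (\<lambda>\<psi>. Re (trace (A ** (real (CARD('d) + n) *\<^sub>R \<psi>))))"

end

theory Submission
  imports Defs
begin

text \<open>On \<open>\<tau>\<close> the outcome \<open>\<psi>\<close> has density proportional to \<open>\<psi>\<^sub>0\<^sub>0\<^sup>p \<psi>\<^sub>1\<^sub>1\<^sup>q\<close> with respect to the invariant
  measure, so the variance only needs moments of entries of \<open>\<psi>\<close>. Diagonal unitaries kill all monomials
  that are not balanced in their row and column indices; the remaining ones are reduced to products of
  diagonal entries by \<open>\<psi>\<^sub>i\<^sub>j \<psi>\<^sub>j\<^sub>i = \<psi>\<^sub>i\<^sub>i \<psi>\<^sub>j\<^sub>j\<close>. Invariance under rotations in a coordinate plane gives
  \<open>(a\<^sub>j + 1) E[M \<psi>\<^sub>i\<^sub>i] = (a\<^sub>i + 1) E[M \<psi>\<^sub>j\<^sub>j]\<close> for a diagonal monomial \<open>M\<close> with exponents \<open>a\<close>, and summing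
  over \<open>i\<close> with trace one yields \<open>E[M \<psi>\<^sub>j\<^sub>j] = (a\<^sub>j + 1) / (N + d) E[M]\<close>, where \<open>N\<close> is the degree of \<open>M\<close>.
  All first and second moments follow by applying this once or twice.\<close>

section \<open>Rank-one projectors\<close>

lemma mat_mult_nth: "(A ** B) $ i $ j = (\<Sum>k\<in>UNIV. A $ i $ k * B $ k $ j)"
  by (simp add: matrix_matrix_mult_def)

lemma ctranspose_nth: "ctranspose A $ i $ j = cnj (A $ j $ i)"
  by (simp add: ctranspose_def)

lemma hermitian_nth: "hermitian A \<Longrightarrow> cnj (A $ i $ j) = A $ j $ i"
  by (metis ctranspose_nth hermitian_def)

lemma ctranspose_mult: "ctranspose (A ** B) = ctranspose B ** ctranspose A"
  by (simp add: vec_eq_iff ctranspose_nth mat_mult_nth mult.commute)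

lemma ctranspose_ctranspose [simp]: "ctranspose (ctranspose A) = A"
  by (simp add: vec_eq_iff ctranspose_nth)

text \<open>Rank is read as the dimension of the row space: dimension one makes every row a multiple
  of a single vector \<open>b\<close>. Later arguments use the factorised form, which splits a
  product of entries into row factors and column factors.\<close>

lemma rank_one_iff_outer_product:
  fixes A :: "complex^'n^'m"
  shows "rank A = 1 \<longleftrightarrow> A \<noteq> 0 \<and> (\<exists>c b. \<forall>i j. A $ i $ j = c i * b $ j)"
proof
  assume A: "rank A = 1"
  then have dim: "vec.dim (rows A) = 1"
    by (simp add: row_rank_def_gen)
  obtain B where B: "rows A \<subseteq> vec.span B" "card B = 1"
    using vec.basis_exists[of "rows A"] dim by metis
  then obtain b where b: "B = {b}"
    by (auto simp: card_1_singleton_iff)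
  have "\<exists>k. row i A = k *s b" for i
  proof -
    have "row i A \<in> vec.span {b}"
      using B b by (auto simp: rows_def)
    then show ?thesis
      by (auto simp: vec.span_singleton)
  qed
  then obtain c where c: "\<And>i. row i A = c i *s b"
    by metis
  have "A $ i $ j = c i * b $ j" for i j
    using arg_cong[OF c[of i], of "\<lambda>v. v $ j"] by (simp add: row_def)
  moreover have "A \<noteq> 0"
  proof
    assume "A = 0"
    then have "rows A \<subseteq> {0}"
      by (auto simp: rows_def row_def vec_eq_iff)
    then have "vec.dim (rows A) \<le> vec.dim ({} :: (complex^'n) set)"
      by (intro vec.dim_mono) auto
    with dim show False by simp
  qed
  ultimately show "A \<noteq> 0 \<and> (\<exists>c b. \<forall>i j. A $ i $ j = c i * b $ j)" by blast
next
  assume "A \<noteq> 0 \<and> (\<exists>c b. \<forall>i j. A $ i $ j = c i * b $ j)"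
  then obtain c b where A: "A \<noteq> 0" and cb: "\<And>i j. A $ i $ j = c i * b $ j"
    by blast
  have row: "row i A = c i *s b" for i
    by (simp add: row_def vec_eq_iff cb)
  then have "rows A \<subseteq> vec.span {b}"
    by (auto simp: rows_def vec.span_singleton)
  then have "vec.dim (rows A) \<le> 1"
    using vec.dim_le_card[of "rows A" "{b}"] by simp
  moreover have "vec.dim (rows A) \<noteq> 0"
  proof
    assume "vec.dim (rows A) = 0"
    then have "rows A \<subseteq> {0}"
      by simp
    then have "row i A = 0" for i
      by (auto simp: rows_def)
    then have "A $ i $ j = 0" for i j
      using arg_cong[of "row i A" 0 "\<lambda>v. v $ j"] by (simp add: row_def)
    with A show False by (simp add: vec_eq_iff)
  qed
  ultimately have "vec.dim (rows A) = 1"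
    by linarith
  then show "rank A = 1"
    by (simp only: row_rank_def_gen)
qed

lemma rank_one_projector_hermitian: "\<psi> \<in> rank_one_projectors \<Longrightarrow> hermitian \<psi>"
  by (simp add: rank_one_projectors_def)

lemma rank_one_projector_outer_product:
  assumes "\<psi> \<in> rank_one_projectors"
  obtains c b where "\<And>i j. \<psi> $ i $ j = c i * b $ j"
  using assms unfolding rank_one_projectors_def rank_one_iff_outer_product by blast

text \<open>Both sides contain the same four factors \<open>c i\<close>, \<open>b $ j\<close>,
  \<open>c k\<close>, \<open>b $ l\<close>; this is the vanishing of the 2 by 2 minors.\<close>

lemma rank_one_projector_exchange:
  assumes "\<psi> \<in> rank_one_projectors"
  shows "\<psi> $ i $ j * \<psi> $ k $ l = \<psi> $ i $ l * \<psi> $ k $ j"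
proof -
  obtain c b where "\<And>i j. \<psi> $ i $ j = c i * b $ j"
    using rank_one_projector_outer_product[OF assms] by blast
  then show ?thesis
    by (simp only: mult_ac)
qed

text \<open>Idempotence together with the exchange of column indices says that each entry equals
  itself times the trace, and some entry is nonzero.\<close>

lemma rank_one_projector_trace:
  assumes "\<psi> \<in> rank_one_projectors"
  shows "(\<Sum>k\<in>UNIV. \<psi> $ k $ k) = 1"
proof -
  have "\<psi> ** \<psi> = \<psi>" "\<psi> \<noteq> 0"
    using assms unfolding rank_one_projectors_def mem_Collect_eq rank_one_iff_outer_product
    by simp_all
  then obtain i j where ij: "\<psi> $ i $ j \<noteq> 0"
    by (auto simp: vec_eq_iff)
  have "\<psi> $ i $ j = (\<Sum>k\<in>UNIV. \<psi> $ i $ k * \<psi> $ k $ j)"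
    using mat_mult_nth[of \<psi> \<psi> i j] by (simp only: \<open>\<psi> ** \<psi> = \<psi>\<close>)
  also have "\<dots> = \<psi> $ i $ j * (\<Sum>k\<in>UNIV. \<psi> $ k $ k)"
    unfolding sum_distrib_left
    by (intro sum.cong refl rank_one_projector_exchange[OF assms])
  finally have "\<psi> $ i $ j = 0 \<or> (\<Sum>k\<in>UNIV. \<psi> $ k $ k) = 1"
    by (rule mult_cancel_left1[THEN iffD1])
  with ij show ?thesis
    by simp
qed

text \<open>Idempotence at a diagonal position, with \<open>\<psi> $ k $ i\<close> rewritten as the
  conjugate of \<open>\<psi> $ i $ k\<close>. Nonnegativity of the diagonal and the bound on all
  entries both rest on it.\<close>

lemma rank_one_projector_diag:
  assumes "\<psi> \<in> rank_one_projectors"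
  shows "\<psi> $ i $ i = of_real (\<Sum>k\<in>UNIV. (cmod (\<psi> $ i $ k))\<^sup>2)"
proof -
  have "\<psi> ** \<psi> = \<psi>"
    using assms by (auto simp: rank_one_projectors_def)
  then have "\<psi> $ i $ i = (\<Sum>k\<in>UNIV. \<psi> $ i $ k * \<psi> $ k $ i)"
    using mat_mult_nth[of \<psi> \<psi> i i] by (simp only:)
  also have "\<dots> = (\<Sum>k\<in>UNIV. of_real ((cmod (\<psi> $ i $ k))\<^sup>2))"
    by (intro sum.cong refl)
      (simp only: complex_norm_square hermitian_nth[OF rank_one_projector_hermitian[OF assms]])
  finally show ?thesis
    by (simp only: of_real_sum)
qed

lemma rank_one_projector_diag_nonneg:
  assumes "\<psi> \<in> rank_one_projectors"
  shows "\<psi> $ i $ i = of_real (Re (\<psi> $ i $ i))" "0 \<le> Re (\<psi> $ i $ i)"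
  by (subst (1 2) rank_one_projector_diag[OF assms], simp)
    (subst rank_one_projector_diag[OF assms], simp add: sum_nonneg)

text \<open>The diagonal is a probability vector, and the squared modulus of an entry is at most the
  diagonal entry of its row. The uniform bound makes every polynomial in the entries
  integrable.\<close>

lemma rank_one_projector_bound:
  assumes "\<psi> \<in> rank_one_projectors"
  shows "cmod (\<psi> $ i $ j) \<le> 1"
proof -
  have "Re (\<psi> $ i $ i) \<le> (\<Sum>k\<in>UNIV. Re (\<psi> $ k $ k))"
    by (intro member_le_sum rank_one_projector_diag_nonneg[OF assms]) auto
  also have "\<dots> = 1"
    using rank_one_projector_trace[OF assms] by (metis Re_sum one_complex.sel(1))
  finally have "Re (\<psi> $ i $ i) \<le> 1" .
  moreover have "(cmod (\<psi> $ i $ j))\<^sup>2 \<le> (\<Sum>k\<in>UNIV. (cmod (\<psi> $ i $ k))\<^sup>2)"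
    by (intro member_le_sum) auto
  ultimately have "(cmod (\<psi> $ i $ j))\<^sup>2 \<le> 1"
    by (subst (asm) rank_one_projector_diag[OF assms]) simp
  then show ?thesis
    by (simp add: abs_square_le_1)
qed

lemma unitary_conj_rank_one_projectors:
  assumes U: "unitary U" and \<psi>: "\<psi> \<in> rank_one_projectors"
  shows "U ** \<psi> ** ctranspose U \<in> rank_one_projectors"
proof -
  let ?V = "ctranspose U" and ?\<phi> = "U ** \<psi> ** ctranspose U"
  have UV: "?V ** U = mat 1" "U ** ?V = mat 1"
    using U by (auto simp: unitary_def)
  have \<psi>': "hermitian \<psi>" "\<psi> ** \<psi> = \<psi>" "\<psi> \<noteq> 0"
    using \<psi> unfolding rank_one_projectors_def mem_Collect_eq rank_one_iff_outer_product by simp_all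
  have "hermitian ?\<phi>"
    using \<psi>'(1) unfolding hermitian_def ctranspose_mult ctranspose_ctranspose
    by (simp only: matrix_mul_assoc)
  moreover have "?\<phi> ** ?\<phi> = U ** (\<psi> ** (?V ** U) ** \<psi>) ** ?V"
    by (simp only: matrix_mul_assoc)
  then have "?\<phi> ** ?\<phi> = ?\<phi>"
    unfolding UV matrix_mul_rid \<psi>'(2) .
  moreover have "?\<phi> \<noteq> 0"
  proof
    assume *: "?\<phi> = 0"
    have "?V ** ?\<phi> ** U = (?V ** U) ** \<psi> ** (?V ** U)"
      by (simp only: matrix_mul_assoc)
    then have "?V ** 0 ** U = \<psi>"
      unfolding * UV matrix_mul_rid matrix_mul_lid .
    moreover have "?V ** 0 ** U = 0"
      by (simp add: vec_eq_iff mat_mult_nth)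
    ultimately show False
      using \<psi>'(3) by simp
  qed
  \<comment> \<open>Conjugation sends the column factor \<open>c\<close> to \<open>U\<close> applied
    to \<open>c\<close>, and the row factor \<open>b\<close> to \<open>b\<close> times the adjoint
    of \<open>U\<close>.\<close>
  moreover have "\<exists>c b. \<forall>i j. ?\<phi> $ i $ j = c i * b $ j"
  proof -
    obtain c b where cb: "\<And>i j. \<psi> $ i $ j = c i * b $ j"
      using rank_one_projector_outer_product[OF \<psi>] by blast
    let ?c = "\<lambda>i. \<Sum>k\<in>UNIV. U $ i $ k * c k"
    let ?b = "\<chi> j. \<Sum>l\<in>UNIV. b $ l * cnj (U $ j $ l)"
    have "(U ** \<psi>) $ i $ l = ?c i * b $ l" for i l
      unfolding mat_mult_nth cb sum_distrib_right mult.assoc ..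
    then have "?\<phi> $ i $ j = (\<Sum>l\<in>UNIV. ?c i * b $ l * cnj (U $ j $ l))" for i j
      by (subst mat_mult_nth) (simp only: ctranspose_nth)
    then have "?\<phi> $ i $ j = ?c i * ?b $ j" for i j
      unfolding vec_lambda_beta sum_distrib_left mult.assoc .
    then show ?thesis
      by (intro exI[of _ ?c] exI[of _ ?b] allI)
  qed
  ultimately show ?thesis
    unfolding rank_one_projectors_def mem_Collect_eq rank_one_iff_outer_product
    by (intro conjI)
qed

section \<open>Unitary invariance\<close>

locale haar_projector =
  fixes H :: "(complex^'d::finite^'d) measure"
  assumes haar: "haar_projector_measure H"
begin

sublocale prob_space H
  using haar by (simp add: haar_projector_measure_def)

lemma space_H: "space H = rank_one_projectors"
  and sets_H: "sets H = sets (restrict_space borel rank_one_projectors)"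
  using haar by (auto simp: haar_projector_measure_def)

lemma borel_measurable_entry [measurable]: "(\<lambda>\<psi>. \<psi> $ i $ j) \<in> borel_measurable H"
  unfolding measurable_cong_sets[OF sets_H refl]
  by (intro measurable_restrict_space1 borel_measurable_continuous_onI continuous_intros)

lemma measurable_unitary_conj:
  assumes "unitary U"
  shows "(\<lambda>\<psi>. U ** \<psi> ** ctranspose U) \<in> measurable H H"
  unfolding measurable_cong_sets[OF sets_H sets_H]
proof (rule measurable_restrict_space3)
  show "(\<lambda>\<psi>. U ** \<psi> ** ctranspose U) \<in> borel_measurable borel"
    unfolding matrix_matrix_mult_def
    by (intro borel_measurable_continuous_onI continuous_intros)
qed (auto intro: unitary_conj_rank_one_projectors assms)

lemma integral_unitary_conj:
  fixes f :: "complex^'d^'d \<Rightarrow> complex"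
  assumes "unitary U" and "f \<in> borel_measurable H"
  shows "(\<integral>\<psi>. f (U ** \<psi> ** ctranspose U) \<partial>H) = integral\<^sup>L H f"
proof -
  have "distr H H (\<lambda>\<psi>. U ** \<psi> ** ctranspose U) = H"
    using haar assms by (simp add: haar_projector_measure_def)
  then show ?thesis
    using integral_distr[OF measurable_unitary_conj[OF assms(1)] assms(2)] by simp
qed

section \<open>Bounded functions and polynomial families on the projectors\<close>

text \<open>Unlike integrability, this property is closed under products, so integrability of any
  polynomial in the entries follows by introduction rules alone.\<close>

definition bounded_measurable :: "(complex^'d^'d \<Rightarrow> complex) \<Rightarrow> bool" where
  "bounded_measurable f \<longleftrightarrow>
     f \<in> borel_measurable H \<and> (\<exists>C. \<forall>\<psi>\<in>space H. cmod (f \<psi>) \<le> C)"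

lemma bounded_measurableD: "bounded_measurable f \<Longrightarrow> f \<in> borel_measurable H"
  by (simp add: bounded_measurable_def)

lemma bounded_measurable_integrable:
  assumes "bounded_measurable f"
  shows "integrable H f"
proof -
  obtain C where "\<forall>\<psi>\<in>space H. cmod (f \<psi>) \<le> C"
    using assms by (auto simp: bounded_measurable_def)
  then show ?thesis
    using assms by (intro integrable_const_bound[of _ C]) (auto simp: bounded_measurable_def)
qed

lemma bounded_measurable_const: "bounded_measurable (\<lambda>_. c)"
  by (auto simp: bounded_measurable_def)

lemma bounded_measurable_entry: "bounded_measurable (\<lambda>\<psi>. \<psi> $ i $ j)"
  by (auto simp: bounded_measurable_def space_H intro!: exI[of _ 1] rank_one_projector_bound)

lemma bounded_measurable_add:
  assumes "bounded_measurable f" "bounded_measurable g"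
  shows "bounded_measurable (\<lambda>\<psi>. f \<psi> + g \<psi>)"
proof -
  obtain C D where "\<forall>\<psi>\<in>space H. cmod (f \<psi>) \<le> C" "\<forall>\<psi>\<in>space H. cmod (g \<psi>) \<le> D"
    using assms by (auto simp: bounded_measurable_def)
  then have "\<forall>\<psi>\<in>space H. cmod (f \<psi> + g \<psi>) \<le> C + D"
    by (auto intro!: norm_triangle_mono)
  then show ?thesis
    using assms by (auto simp: bounded_measurable_def)
qed

lemma bounded_measurable_mult:
  assumes "bounded_measurable f" "bounded_measurable g"
  shows "bounded_measurable (\<lambda>\<psi>. f \<psi> * g \<psi>)"
proof -
  obtain C D where "\<forall>\<psi>\<in>space H. cmod (f \<psi>) \<le> C" "\<forall>\<psi>\<in>space H. cmod (g \<psi>) \<le> D"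
    using assms by (auto simp: bounded_measurable_def)
  then have "\<forall>\<psi>\<in>space H. cmod (f \<psi> * g \<psi>) \<le> C * D"
    by (auto simp: norm_mult intro!: mult_mono' )
  then show ?thesis
    using assms by (auto simp: bounded_measurable_def)
qed

lemma bounded_measurable_uminus: "bounded_measurable f \<Longrightarrow> bounded_measurable (\<lambda>\<psi>. - f \<psi>)"
  by (auto simp: bounded_measurable_def)

lemma bounded_measurable_diff:
  "bounded_measurable f \<Longrightarrow> bounded_measurable g \<Longrightarrow> bounded_measurable (\<lambda>\<psi>. f \<psi> - g \<psi>)"
  using bounded_measurable_add[of f "\<lambda>\<psi>. - g \<psi>"] by (simp add: bounded_measurable_uminus)

lemma bounded_measurable_power:
  "bounded_measurable f \<Longrightarrow> bounded_measurable (\<lambda>\<psi>. f \<psi> ^ k)"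
  by (induction k) (auto intro: bounded_measurable_const bounded_measurable_mult)

lemma bounded_measurable_sum:
  "(\<And>i. i \<in> S \<Longrightarrow> bounded_measurable (f i)) \<Longrightarrow> bounded_measurable (\<lambda>\<psi>. \<Sum>i\<in>S. f i \<psi>)"
  by (induction S rule: infinite_finite_induct)
     (auto intro: bounded_measurable_const bounded_measurable_add)

lemma bounded_measurable_prod:
  "(\<And>i. i \<in> S \<Longrightarrow> bounded_measurable (f i)) \<Longrightarrow> bounded_measurable (\<lambda>\<psi>. \<Prod>i\<in>S. f i \<psi>)"
  by (induction S rule: infinite_finite_induct)
     (auto intro: bounded_measurable_const bounded_measurable_mult)

lemmas bounded_measurable_intros =
  bounded_measurable_const bounded_measurable_entry bounded_measurable_add
  bounded_measurable_diff bounded_measurable_mult bounded_measurable_uminus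
  bounded_measurable_power bounded_measurable_sum bounded_measurable_prod

text \<open>Polynomials in an auxiliary parameter whose coefficients depend on
  \<open>\<psi>\<close>. The degree bound is uniform in \<open>\<psi>\<close>, so that integrating
  over \<open>\<psi>\<close> gives a polynomial again.\<close>

definition poly_family :: "(complex^'d^'d \<Rightarrow> complex poly) \<Rightarrow> bool" where
  "poly_family P \<longleftrightarrow>
     (\<exists>m. \<forall>\<psi>. degree (P \<psi>) \<le> m) \<and> (\<forall>k. bounded_measurable (\<lambda>\<psi>. coeff (P \<psi>) k))"

lemma poly_family_const: "poly_family (\<lambda>_. p)"
  by (auto simp: poly_family_def bounded_measurable_const)

lemma poly_family_pCons:
  assumes "bounded_measurable f" "poly_family P"
  shows "poly_family (\<lambda>\<psi>. pCons (f \<psi>) (P \<psi>))"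
proof -
  obtain m where "\<And>\<psi>. degree (P \<psi>) \<le> m"
    using assms by (auto simp: poly_family_def)
  then have "degree (pCons (f \<psi>) (P \<psi>)) \<le> Suc m" for \<psi>
    by (meson Suc_le_mono degree_pCons_le order_trans)
  moreover have "bounded_measurable (\<lambda>\<psi>. coeff (pCons (f \<psi>) (P \<psi>)) k)" for k
    using assms by (cases k) (auto simp: poly_family_def)
  ultimately show ?thesis
    unfolding poly_family_def by blast
qed

lemma poly_family_mult:
  assumes "poly_family P" "poly_family Q"
  shows "poly_family (\<lambda>\<psi>. P \<psi> * Q \<psi>)"
proof -
  obtain m n where "\<And>\<psi>. degree (P \<psi>) \<le> m" "\<And>\<psi>. degree (Q \<psi>) \<le> n"
    using assms by (auto simp: poly_family_def)
  then have "degree (P \<psi> * Q \<psi>) \<le> m + n" for \<psi>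
    by (meson add_mono degree_mult_le order_trans)
  moreover have "bounded_measurable (\<lambda>\<psi>. coeff (P \<psi> * Q \<psi>) k)" for k
    unfolding coeff_mult using assms
    by (auto simp: poly_family_def intro!: bounded_measurable_intros)
  ultimately show ?thesis
    by (auto simp: poly_family_def)
qed

lemma poly_family_power: "poly_family P \<Longrightarrow> poly_family (\<lambda>\<psi>. P \<psi> ^ k)"
  by (induction k) (auto intro: poly_family_const poly_family_mult)

lemmas poly_family_intros =
  poly_family_const poly_family_pCons poly_family_mult poly_family_power

text \<open>Integrating coefficient by coefficient gives one polynomial \<open>Q\<close> in the
  parameter. It vanishes at every real number, hence is zero, and so are its coefficients.\<close>

lemma integral_coeff_eq_0:
  assumes P: "poly_family P" and 0: "\<And>t :: real. (\<integral>\<psi>. poly (P \<psi>) (of_real t) \<partial>H) = 0"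
  shows "(\<integral>\<psi>. coeff (P \<psi>) k \<partial>H) = 0"
proof -
  obtain m where m: "\<And>\<psi>. degree (P \<psi>) \<le> m"
    using P by (auto simp: poly_family_def)
  have int: "integrable H (\<lambda>\<psi>. coeff (P \<psi>) k)" for k
    using P by (auto simp: poly_family_def intro: bounded_measurable_integrable)
  define Q where "Q = (\<Sum>k\<le>m. monom (\<integral>\<psi>. coeff (P \<psi>) k \<partial>H) k)"
  have "poly Q (of_real t) = 0" for t :: real
  proof -
    have "poly (P \<psi>) x = (\<Sum>k\<le>m. coeff (P \<psi>) k * x ^ k)" for \<psi> x
      by (subst poly_as_sum_of_monoms'[OF m, symmetric]) (simp only: poly_sum poly_monom)
    then have "(\<integral>\<psi>. poly (P \<psi>) (of_real t) \<partial>H)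
        = (\<integral>\<psi>. (\<Sum>k\<le>m. coeff (P \<psi>) k * of_real t ^ k) \<partial>H)"
      by (simp only:)
    also have "\<dots> = (\<Sum>k\<le>m. (\<integral>\<psi>. coeff (P \<psi>) k \<partial>H) * of_real t ^ k)"
      by (subst Bochner_Integration.integral_sum) (auto intro: integrable_mult_left int)
    also have "\<dots> = poly Q (of_real t)"
      by (simp add: Q_def poly_sum poly_monom)
    finally show ?thesis
      using 0 by simp
  qed
  then have "range of_real \<subseteq> {x. poly Q x = 0}"
    by auto
  moreover have "infinite (range (of_real :: real \<Rightarrow> complex))"
    by (simp add: finite_image_iff inj_def infinite_UNIV_char_0)
  ultimately have "Q = 0"
    using poly_roots_finite[of Q] finite_subset by blast
  show ?thesis
  proof (cases "k \<le> m")
    case True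
    have "coeff Q k = (\<integral>\<psi>. coeff (P \<psi>) k \<partial>H)"
      using True by (simp add: Q_def coeff_sum sum.delta')
    then show ?thesis
      using \<open>Q = 0\<close> by simp
  next
    case False
    then have "coeff (P \<psi>) k = 0" for \<psi>
      using m[of \<psi>] by (intro coeff_eq_0) linarith
    then show ?thesis by simp
  qed
qed

end

section \<open>Phase matrices and plane rotations\<close>

lemma unitary_iff_left: "unitary U \<longleftrightarrow> ctranspose U ** U = mat 1"
  by (auto simp: unitary_def matrix_left_right_inverse)

lemma conj_nth:
  "(U ** \<psi> ** ctranspose U) $ a $ b = (\<Sum>l\<in>UNIV. (\<Sum>k\<in>UNIV. U $ a $ k * \<psi> $ k $ l) * cnj (U $ b $ l))"
  by (simp add: mat_mult_nth ctranspose_nth)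

text \<open>The phase is \<open>\<i>\<close> and not a sign because a sign would leave the square of
  an off-diagonal entry fixed, whereas \<open>\<i>\<close> multiplies it by \<open>-1\<close>. With
  at most two entries besides a diagonal monomial, powers of \<open>\<i>\<close> detect every
  imbalance of row and column indices.\<close>

definition phase_matrix :: "'d \<Rightarrow> complex^'d^'d" where
  "phase_matrix m = (\<chi> a b. if a = b then (if a = m then \<i> else 1) else 0)"

lemma phase_matrix_row:
  "(\<Sum>k\<in>UNIV. phase_matrix m $ a $ k * f k) = (if a = m then \<i> else 1) * f a"
proof -
  have "(\<Sum>k\<in>UNIV. phase_matrix m $ a $ k * f k)
      = (\<Sum>k\<in>UNIV. if k = a then (if a = m then \<i> else 1) * f a else 0)"
    by (intro sum.cong) (auto simp: phase_matrix_def)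
  then show ?thesis
    by simp
qed

lemma phase_matrix_row':
  "(\<Sum>k\<in>UNIV. f k * cnj (phase_matrix m $ a $ k)) = f a * (if a = m then - \<i> else 1)"
  using arg_cong[OF phase_matrix_row[of m a "\<lambda>k. cnj (f k)"], of cnj]
  by (simp add: mult.commute)

lemma unitary_phase_matrix: "unitary (phase_matrix m)"
proof -
  have "(ctranspose (phase_matrix m) ** phase_matrix m) $ a $ b = mat 1 $ a $ b" for a b
  proof -
    have "(ctranspose (phase_matrix m) ** phase_matrix m) $ a $ b
        = (\<Sum>k\<in>UNIV. if k = a then (if a = b then 1 else 0) else 0)"
      unfolding mat_mult_nth by (intro sum.cong) (auto simp: ctranspose_nth phase_matrix_def)
    then show ?thesis
      by (simp add: mat_def)
  qed
  then show ?thesis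
    by (simp add: unitary_iff_left vec_eq_iff)
qed

lemma phase_matrix_conj:
  "(phase_matrix m ** \<psi> ** ctranspose (phase_matrix m)) $ a $ b
     = (if a = m then \<i> else 1) * \<psi> $ a $ b * (if b = m then - \<i> else 1)"
  unfolding conj_nth phase_matrix_row phase_matrix_row' ..

definition plane_rotation :: "'d \<Rightarrow> 'd \<Rightarrow> real \<Rightarrow> real \<Rightarrow> complex^'d^'d" where
  "plane_rotation i j c s = (\<chi> a b.
     if a = i then (if b = i then of_real c else if b = j then of_real s else 0)
     else if a = j then (if b = j then of_real c else if b = i then - of_real s else 0)
     else if a = b then 1 else 0)"

lemma plane_rotation_row:
  assumes "i \<noteq> j"
  shows "(\<Sum>k\<in>UNIV. plane_rotation i j c s $ a $ k * f k) =
    (if a = i then of_real c * f i + of_real s * f j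
     else if a = j then of_real c * f j - of_real s * f i else f a)"
proof -
  have "(\<Sum>k\<in>UNIV. plane_rotation i j c s $ a $ k * f k) =
    (\<Sum>k\<in>UNIV. (if k = i then (if a = i then of_real c else if a = j then - of_real s else 0) * f i else 0) +
      (if k = j then (if a = j then of_real c else if a = i then of_real s else 0) * f j else 0) +
      (if k = a then (if a \<noteq> i \<and> a \<noteq> j then f a else 0) else 0))"
    using assms by (intro sum.cong) (auto simp: plane_rotation_def)
  also have "\<dots> = (if a = i then of_real c else if a = j then - of_real s else 0) * f i +
      (if a = j then of_real c else if a = i then of_real s else 0) * f j +
      (if a \<noteq> i \<and> a \<noteq> j then f a else 0)"
    unfolding sum.distrib by simp
  also have "\<dots> = (if a = i then of_real c * f i + of_real s * f j
     else if a = j then of_real c * f j - of_real s * f i else f a)"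
    using assms by auto
  finally show ?thesis .
qed

lemma plane_rotation_row':
  assumes "i \<noteq> j"
  shows "(\<Sum>k\<in>UNIV. f k * cnj (plane_rotation i j c s $ a $ k)) =
    (if a = i then of_real c * f i + of_real s * f j
     else if a = j then of_real c * f j - of_real s * f i else f a)"
  using arg_cong[OF plane_rotation_row[OF assms, of c s a "\<lambda>k. cnj (f k)"], of cnj]
  by (simp add: mult.commute)

lemma plane_rotation_conj:
  assumes "i \<noteq> j"
  shows "(plane_rotation i j c s ** \<psi> ** ctranspose (plane_rotation i j c s)) $ a $ b =
    (let r = (\<lambda>l. if a = i then of_real c * \<psi> $ i $ l + of_real s * \<psi> $ j $ l
        else if a = j then of_real c * \<psi> $ j $ l - of_real s * \<psi> $ i $ l else \<psi> $ a $ l)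
     in if b = i then of_real c * r i + of_real s * r j
        else if b = j then of_real c * r j - of_real s * r i else r b)"
  unfolding conj_nth plane_rotation_row[OF assms] plane_rotation_row'[OF assms] Let_def ..

lemma unitary_plane_rotation:
  assumes "i \<noteq> j" and "c\<^sup>2 + s\<^sup>2 = 1"
  shows "unitary (plane_rotation i j c s)"
proof -
  let ?U = "plane_rotation i j c s"
  have cs: "complex_of_real c * of_real c + of_real s * of_real s = 1"
    using assms(2) by (metis of_real_1 of_real_add of_real_mult power2_eq_square)
  have "(?U ** ctranspose ?U) $ a $ b = mat 1 $ a $ b" for a b
    unfolding mat_mult_nth ctranspose_nth plane_rotation_row'[OF assms(1)]
    using assms(1) cs by (auto simp: mat_def plane_rotation_def add.commute)
  then have "?U ** ctranspose ?U = mat 1"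
    by (simp add: vec_eq_iff)
  then show ?thesis
    by (simp add: unitary_def matrix_left_right_inverse)
qed

section \<open>Moments that vanish by phase invariance\<close>

context haar_projector
begin

text \<open>Invariance shows that the integral equals \<open>c\<close> times itself.\<close>

lemma integral_eq_0_phase:
  assumes "bounded_measurable f" and "c \<noteq> 1"
    and "\<And>\<psi>. f (phase_matrix m ** \<psi> ** ctranspose (phase_matrix m)) = c * f \<psi>"
  shows "integral\<^sup>L H f = 0"
proof -
  have "integral\<^sup>L H f = c * integral\<^sup>L H f"
    using integral_unitary_conj[OF unitary_phase_matrix[of m] bounded_measurableD[OF assms(1)]]
    by (simp add: assms(3))
  then show ?thesis
    using assms(2) by simp
qed

definition diag_monom :: "('d \<Rightarrow> nat) \<Rightarrow> complex^'d^'d \<Rightarrow> complex" where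
  "diag_monom a \<psi> = (\<Prod>k\<in>UNIV. \<psi> $ k $ k ^ a k)"

lemma bounded_measurable_diag_monom: "bounded_measurable (diag_monom a)"
  unfolding diag_monom_def by (intro bounded_measurable_intros)

lemma diag_monom_phase:
  "diag_monom a (phase_matrix m ** \<psi> ** ctranspose (phase_matrix m)) = diag_monom a \<psi>"
proof -
  have "\<i> * x * - \<i> = x" for x
    by (simp add: complex_eq_iff)
  then show ?thesis
    unfolding diag_monom_def phase_matrix_conj by (intro prod.cong) auto
qed

lemma integral_diag_monom_offdiag:
  assumes "i \<noteq> j"
  shows "(\<integral>\<psi>. diag_monom a \<psi> * \<psi> $ i $ j \<partial>H) = 0"
  using assms
  by (intro integral_eq_0_phase[where c = \<i> and m = i])
     (auto simp: diag_monom_phase phase_matrix_conj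
       intro!: bounded_measurable_intros bounded_measurable_diag_monom)

lemma integral_diag_monom_unbalanced:
  assumes "\<not> (i = j \<and> k = l)" and "\<not> (i = l \<and> k = j)"
  shows "(\<integral>\<psi>. diag_monom a \<psi> * (\<psi> $ i $ j * \<psi> $ k $ l) \<partial>H) = 0"
proof -
  define u where "u m x = (if x = m then \<i> else 1)" for m x :: 'd
  define v where "v m x = (if x = m then - \<i> else 1)" for m x :: 'd
  \<comment> \<open>The index \<open>m\<close> is chosen to occur unequally often as a row and as a
    column index: the total factor is \<open>\<i>\<close> in the first case, \<open>- \<i>\<close>
    in the second, and \<open>\<i>\<close> or \<open>-1\<close> in the third.\<close>
  define m where "m = (if i = j then k else if i = l then j else i)"
  show ?thesis
  proof (rule integral_eq_0_phase[where c = "u m i * v m j * (u m k * v m l)" and m = m])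
    show "bounded_measurable (\<lambda>\<psi>. diag_monom a \<psi> * (\<psi> $ i $ j * \<psi> $ k $ l))"
      by (intro bounded_measurable_intros bounded_measurable_diag_monom)
    show "u m i * v m j * (u m k * v m l) \<noteq> 1"
      using assms by (auto simp: m_def u_def v_def complex_eq_iff split: if_splits)
  qed (simp add: diag_monom_phase phase_matrix_conj u_def v_def)
qed

end

section \<open>Moments of the diagonal entries\<close>

lemma coeff_mult_1: "coeff (p * q) (Suc 0) = coeff p 0 * coeff q (Suc 0) + coeff p (Suc 0) * coeff q 0"
  by (simp add: coeff_mult)

lemma coeff_power_1:
  fixes p :: "'a::comm_semiring_1 poly"
  shows "coeff (p ^ n) (Suc 0) = of_nat n * coeff p 0 ^ (n - 1) * coeff p (Suc 0)"
proof (induction n)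
  case (Suc n)
  then show ?case
    by (cases n) (simp_all add: coeff_mult_1 coeff_0_power coeff_mult_0 algebra_simps)
qed simp

context haar_projector
begin

lemma diag_monom_split:
  assumes "i \<noteq> j"
  shows "diag_monom a \<psi> = \<psi> $ i $ i ^ a i * \<psi> $ j $ j ^ a j * (\<Prod>k\<in>UNIV - {i, j}. \<psi> $ k $ k ^ a k)"
proof -
  have "(UNIV :: 'd set) = insert i (insert j (UNIV - {i, j}))"
    by auto
  then have "diag_monom a \<psi> = (\<Prod>k\<in>insert i (insert j (UNIV - {i, j})). \<psi> $ k $ k ^ a k)"
    unfolding diag_monom_def by simp
  then show ?thesis
    using assms by (simp add: mult.assoc)
qed

lemma diag_monom_upd:
  assumes "i \<noteq> j"
  shows "diag_monom (a(i := m)) \<psi> = \<psi> $ i $ i ^ m * \<psi> $ j $ j ^ a j * (\<Prod>k\<in>UNIV - {i, j}. \<psi> $ k $ k ^ a k)"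
  using assms by (subst diag_monom_split[OF assms]) (auto intro!: prod.cong)

text \<open>For a rotation by \<open>arctan t\<close> in the plane of \<open>i\<close> and \<open>j\<close>, the integral of the rotated
  \<open>diag_monom a \<psi> * \<psi> $ i $ j\<close> vanishes for every \<open>t\<close>. Up to a power of \<open>1 + t\<^sup>2\<close> the integrand is a
  polynomial in \<open>t\<close>, and the vanishing of its linear coefficient is the claimed relation. This replaces
  a differentiation under the integral sign.\<close>

lemma integral_diag_monom_swap:
  assumes "i \<noteq> j"
  shows "of_nat (a j + 1) * (\<integral>\<psi>. diag_monom a \<psi> * \<psi> $ i $ i \<partial>H)
       = of_nat (a i + 1) * (\<integral>\<psi>. diag_monom a \<psi> * \<psi> $ j $ j \<partial>H)"
proof -
  define g where "g \<psi> = (\<Prod>k\<in>UNIV - {i, j}. \<psi> $ k $ k ^ a k)" for \<psi> :: "complex^'d^'d"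
  define w where "w \<psi> = \<psi> $ i $ j + \<psi> $ j $ i" for \<psi> :: "complex^'d^'d"
  \<comment> \<open>The first three bases are the rotated entries at \<open>i i\<close>,
    \<open>j j\<close> and \<open>i j\<close>, divided by the squared cosine and written as
    polynomials in the tangent \<open>t\<close>. The factor \<open>g \<psi>\<close> collects the
    diagonal entries that the rotation leaves alone.\<close>
  define P where "P \<psi> = [:\<psi> $ i $ i, w \<psi>, \<psi> $ j $ j:] ^ a i * [:\<psi> $ j $ j, - w \<psi>, \<psi> $ i $ i:] ^ a j
    * [:\<psi> $ i $ j, \<psi> $ j $ j - \<psi> $ i $ i, - \<psi> $ j $ i:] * [:g \<psi>:]" for \<psi>
  have g: "bounded_measurable g" and w: "bounded_measurable w"
    unfolding g_def w_def by (intro bounded_measurable_intros)+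
  have P: "poly_family P"
    unfolding P_def by (intro poly_family_intros bounded_measurable_intros g w)
  have "(\<integral>\<psi>. poly (P \<psi>) (of_real t) \<partial>H) = 0" for t :: real
  proof -
    \<comment> \<open>\<open>c\<close> and \<open>t * c\<close> are the cosine and sine of
      \<open>arctan t\<close>.\<close>
    define c where "c = 1 / sqrt (1 + t\<^sup>2)"
    define R where "R = plane_rotation i j c (t * c)"
    have "1 + t\<^sup>2 > 0"
      by (simp add: add_pos_nonneg)
    then have c: "c \<noteq> 0" "c\<^sup>2 + (t * c)\<^sup>2 = 1"
      by (auto simp: c_def power_mult_distrib power_divide field_simps)
    have eq: "diag_monom a (R ** \<psi> ** ctranspose R) * (R ** \<psi> ** ctranspose R) $ i $ j
        = of_real c ^ (2 * (a i + a j + 1)) * poly (P \<psi>) (of_real t)" for \<psi>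
    proof -
      have ii: "(R ** \<psi> ** ctranspose R) $ i $ i
          = (of_real c)\<^sup>2 * poly [:\<psi> $ i $ i, w \<psi>, \<psi> $ j $ j:] (of_real t)"
        unfolding R_def plane_rotation_conj[OF assms]
        by (simp add: Let_def w_def power2_eq_square algebra_simps)
      have jj: "(R ** \<psi> ** ctranspose R) $ j $ j
          = (of_real c)\<^sup>2 * poly [:\<psi> $ j $ j, - w \<psi>, \<psi> $ i $ i:] (of_real t)"
        unfolding R_def plane_rotation_conj[OF assms] using assms
        by (simp add: Let_def w_def power2_eq_square algebra_simps)
      have ij: "(R ** \<psi> ** ctranspose R) $ i $ j
          = (of_real c)\<^sup>2 * poly [:\<psi> $ i $ j, \<psi> $ j $ j - \<psi> $ i $ i, - \<psi> $ j $ i:] (of_real t)"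
        unfolding R_def plane_rotation_conj[OF assms] using assms
        by (simp add: Let_def power2_eq_square algebra_simps)
      have gg: "(\<Prod>k\<in>UNIV - {i, j}. (R ** \<psi> ** ctranspose R) $ k $ k ^ a k) = poly [:g \<psi>:] (of_real t)"
        unfolding R_def plane_rotation_conj[OF assms] g_def
        by (simp add: Let_def)
      show ?thesis
        unfolding diag_monom_split[OF assms] ii jj ij gg P_def poly_mult poly_power
          power_mult_distrib power_mult power_add
        by (simp only: mult_ac power_one_right)
    qed
    have "(\<integral>\<psi>. diag_monom a (R ** \<psi> ** ctranspose R) * (R ** \<psi> ** ctranspose R) $ i $ j \<partial>H) = 0"
      unfolding R_def
      by (subst integral_unitary_conj[where f = "\<lambda>\<psi>. diag_monom a \<psi> * \<psi> $ i $ j"])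
         (auto intro!: unitary_plane_rotation assms c integral_diag_monom_offdiag
           bounded_measurableD bounded_measurable_intros bounded_measurable_diag_monom)
    then show ?thesis
      unfolding eq using c(1) by simp
  qed
  then have 1: "(\<integral>\<psi>. coeff (P \<psi>) 1 \<partial>H) = 0"
    using P by (rule integral_coeff_eq_0[rotated])
  \<comment> \<open>If \<open>a i = 0\<close>, truncated subtraction gives \<open>a1 = a\<close>;
    this is harmless, since the term with \<open>a1\<close> carries the factor
    \<open>of_nat (a i)\<close>. The same holds for \<open>a2\<close>.\<close>
  define a1 where "a1 = a(i := a i - 1)"
  define a2 where "a2 = a(j := a j - 1)"
  let ?f = "\<lambda>a i j \<psi>. diag_monom a \<psi> * \<psi> $ i $ j"
  let ?h = "\<lambda>a \<psi>. diag_monom a \<psi> * (\<psi> $ i $ j * \<psi> $ i $ j)"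
  have coeff: "coeff (P \<psi>) 1 = of_nat (a i + 1) * ?f a j j \<psi> - of_nat (a j + 1) * ?f a i i \<psi>
      + (of_nat (a i) * ?h a1 \<psi> - of_nat (a j) * ?h a2 \<psi>)" if "\<psi> \<in> space H" for \<psi>
  proof -
    define x y z z' where xyz: "x = \<psi> $ i $ i" "y = \<psi> $ j $ j" "z = \<psi> $ i $ j" "z' = \<psi> $ j $ i"
    \<comment> \<open>The exchange identity makes the mixed product diagonal. What remains off the
      diagonal is the square \<open>z * z\<close>, whose weighted integrals \<open>?h\<close> vanish
      because it is unbalanced.\<close>
    have zz: "z * z' = x * y"
      unfolding xyz using that by (intro rank_one_projector_exchange) (simp add: space_H)
    have zz: "(z + z') * z = z * z + x * y"
      using zz by (simp add: algebra_simps)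
    have "coeff (P \<psi>) 1 = (of_nat (a i) * x ^ (a i - 1) * y ^ a j * ((z + z') * z)
        - of_nat (a j) * x ^ a i * y ^ (a j - 1) * ((z + z') * z) + x ^ a i * y ^ a j * (y - x)) * g \<psi>"
      unfolding P_def One_nat_def coeff_mult_1 coeff_power_1 coeff_mult_0 coeff_0_power w_def
      by (simp add: xyz[symmetric]) (simp add: algebra_simps)
    also have "\<dots> = (of_nat (a i) * (x ^ (a i - 1) * x) * y ^ a j * y + of_nat (a i) * x ^ (a i - 1) * y ^ a j * (z * z)
        - of_nat (a j) * x ^ a i * (y ^ (a j - 1) * y) * x - of_nat (a j) * x ^ a i * y ^ (a j - 1) * (z * z)
        + x ^ a i * y ^ a j * (y - x)) * g \<psi>"
      unfolding zz by (simp add: algebra_simps)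
    \<comment> \<open>For exponent zero the power identity itself fails, but then the factor
      \<open>of_nat (a i)\<close> is zero.\<close>
    also have "of_nat (a i) * (x ^ (a i - 1) * x) = of_nat (a i) * x ^ a i"
      by (cases "a i") auto
    also have "of_nat (a j) * x ^ a i * (y ^ (a j - 1) * y) = of_nat (a j) * x ^ a i * y ^ a j"
      by (cases "a j") auto
    finally have "coeff (P \<psi>) 1 = (of_nat (a i) * x ^ a i * y ^ a j * y + of_nat (a i) * x ^ (a i - 1) * y ^ a j * (z * z)
        - of_nat (a j) * x ^ a i * y ^ a j * x - of_nat (a j) * x ^ a i * y ^ (a j - 1) * (z * z)
        + x ^ a i * y ^ a j * (y - x)) * g \<psi>" .
    moreover have "diag_monom a \<psi> = x ^ a i * y ^ a j * g \<psi>"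
      "diag_monom a1 \<psi> = x ^ (a i - 1) * y ^ a j * g \<psi>"
      unfolding a1_def diag_monom_upd[OF assms] diag_monom_split[OF assms, of a] g_def xyz by simp_all
    moreover have "diag_monom a2 \<psi> = x ^ a i * y ^ (a j - 1) * g \<psi>"
      unfolding a2_def diag_monom_upd[OF assms[symmetric]] g_def xyz
      by (simp add: insert_commute)
    ultimately show ?thesis
      unfolding xyz[symmetric] by (simp add: algebra_simps)
  qed
  have "(\<integral>\<psi>. coeff (P \<psi>) 1 \<partial>H) = (\<integral>\<psi>. of_nat (a i + 1) * ?f a j j \<psi> - of_nat (a j + 1) * ?f a i i \<psi>
      + (of_nat (a i) * ?h a1 \<psi> - of_nat (a j) * ?h a2 \<psi>) \<partial>H)"
    by (intro Bochner_Integration.integral_cong refl coeff)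
  also have "\<dots> = of_nat (a i + 1) * integral\<^sup>L H (?f a j j) - of_nat (a j + 1) * integral\<^sup>L H (?f a i i)
      + (of_nat (a i) * integral\<^sup>L H (?h a1) - of_nat (a j) * integral\<^sup>L H (?h a2))"
  proof -
    have "integrable H (?f a i j)" "integrable H (?h a)" for a i j
      by (intro bounded_measurable_integrable bounded_measurable_intros bounded_measurable_diag_monom)+
    then show ?thesis by simp
  qed
  finally have "(\<integral>\<psi>. coeff (P \<psi>) 1 \<partial>H)
      = of_nat (a i + 1) * integral\<^sup>L H (?f a j j) - of_nat (a j + 1) * integral\<^sup>L H (?f a i i)
      + (of_nat (a i) * integral\<^sup>L H (?h a1) - of_nat (a j) * integral\<^sup>L H (?h a2))" .
  moreover have "integral\<^sup>L H (?h b) = 0" for b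
    using assms by (intro integral_diag_monom_unbalanced) auto
  ultimately show ?thesis
    using 1 by simp
qed

lemma integral_diag_monom_Suc:
  "of_nat (sum a UNIV + CARD('d)) * (\<integral>\<psi>. diag_monom a \<psi> * \<psi> $ j $ j \<partial>H)
     = of_nat (a j + 1) * (\<integral>\<psi>. diag_monom a \<psi> \<partial>H)"
proof -
  have "(\<integral>\<psi>. diag_monom a \<psi> \<partial>H) = (\<integral>\<psi>. (\<Sum>k\<in>UNIV. diag_monom a \<psi> * \<psi> $ k $ k) \<partial>H)"
    by (intro Bochner_Integration.integral_cong refl)
       (simp add: space_H rank_one_projector_trace flip: sum_distrib_left)
  also have "\<dots> = (\<Sum>k\<in>UNIV. \<integral>\<psi>. diag_monom a \<psi> * \<psi> $ k $ k \<partial>H)"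
    by (intro Bochner_Integration.integral_sum bounded_measurable_integrable
        bounded_measurable_intros bounded_measurable_diag_monom)
  finally have "of_nat (a j + 1) * (\<integral>\<psi>. diag_monom a \<psi> \<partial>H)
      = (\<Sum>k\<in>UNIV. of_nat (a j + 1) * (\<integral>\<psi>. diag_monom a \<psi> * \<psi> $ k $ k \<partial>H))"
    by (simp only: sum_distrib_left)
  also have "\<dots> = (\<Sum>k\<in>UNIV. of_nat (a k + 1) * (\<integral>\<psi>. diag_monom a \<psi> * \<psi> $ j $ j \<partial>H))"
  proof (intro sum.cong refl)
    fix k
    show "of_nat (a j + 1) * (\<integral>\<psi>. diag_monom a \<psi> * \<psi> $ k $ k \<partial>H)
        = of_nat (a k + 1) * (\<integral>\<psi>. diag_monom a \<psi> * \<psi> $ j $ j \<partial>H)"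
      by (cases "k = j") (simp only:, rule integral_diag_monom_swap)
  qed
  also have "\<dots> = of_nat (sum a UNIV + CARD('d)) * (\<integral>\<psi>. diag_monom a \<psi> * \<psi> $ j $ j \<partial>H)"
    by (simp add: sum.distrib flip: sum_distrib_right)
  finally show ?thesis ..
qed

lemma diag_monom_Suc: "diag_monom (a(j := a j + 1)) \<psi> = diag_monom a \<psi> * \<psi> $ j $ j"
proof -
  have "diag_monom b \<psi> = \<psi> $ j $ j ^ b j * (\<Prod>k\<in>UNIV - {j}. \<psi> $ k $ k ^ b k)" for b
    unfolding diag_monom_def by (intro prod.remove) auto
  from this[of a] this[of "a(j := a j + 1)"] show ?thesis
    by simp
qed

end

section \<open>Joint moments and moments of the trace\<close>

text \<open>Indexing by pairs turns the square of the trace into a double sum over two pairs, in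
  which coincidence of indices becomes a single equation between pairs.\<close>

lemma trace_mult_pairs:
  fixes A B :: "complex^'d^'d"
  shows "trace (A ** B) = (\<Sum>p\<in>UNIV. A $ fst p $ snd p * B $ snd p $ fst p)"
proof -
  have "trace (A ** B) = (\<Sum>i\<in>UNIV. \<Sum>k\<in>UNIV. A $ i $ k * B $ k $ i)"
    by (simp add: trace_def mat_mult_nth)
  then show ?thesis
    by (simp only: sum.cartesian_product UNIV_Times_UNIV case_prod_unfold)
qed

lemma sum_pairs_diag:
  fixes f :: "'d::finite \<Rightarrow> complex"
  shows "(\<Sum>p\<in>UNIV. if fst p = snd p then f (fst p) else 0) = (\<Sum>i\<in>UNIV. f i)"
proof -
  have "(\<Sum>p\<in>UNIV. if fst p = snd p then f (fst p) else 0)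
      = (\<Sum>i\<in>UNIV. \<Sum>k\<in>UNIV. if i = k then f i else 0)"
    by (simp only: sum.cartesian_product UNIV_Times_UNIV case_prod_unfold)
  then show ?thesis
    by simp
qed

text \<open>The three summands have the shape of the second moments of two entries: a product, a
  term at the partner \<open>g p\<close>, and a correction on the diagonal.\<close>

lemma sum_product_plus_delta:
  fixes d e f :: "'x::finite \<Rightarrow> 'c::comm_ring_1"
  shows "(\<Sum>p\<in>UNIV. \<Sum>q\<in>UNIV. d p * d q + (if q = g p then f p else 0) - (if q = p then e p else 0))
     = (sum d UNIV)\<^sup>2 + sum f UNIV - sum e UNIV"
  unfolding sum_subtractf sum.distrib power2_eq_square sum_product by simp

context haar_projector
begin

text \<open>These are the moments of the Dirichlet distribution with all parameters one, that is, of
  the uniform distribution on the simplex. The induction on the degree removes one diagonal factor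
  at a time; multiplied out, the formula needs no division.\<close>

lemma integral_diag_monom:
  "fact (CARD('d) + sum a UNIV - 1) * (\<integral>\<psi>. diag_monom a \<psi> \<partial>H)
     = fact (CARD('d) - 1) * (\<Prod>k\<in>UNIV. fact (a k))"
proof (induction "sum a UNIV" arbitrary: a)
  case 0
  then show ?case
    by (simp add: diag_monom_def prob_space)
next
  case (Suc n)
  then obtain j where j: "a j > 0"
    by (metis gr0I sum.neutral nat.simps(3))
  define b where "b = a(j := a j - 1)"
  have a: "a = b(j := b j + 1)"
    using j by (auto simp: b_def)
  have prod: "(\<Prod>k\<in>UNIV. fact (c k)) = (fact (c j) * (\<Prod>k\<in>UNIV - {j}. fact (c k)) :: complex)" for c :: "'d \<Rightarrow> nat"
    by (intro prod.remove) auto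
  have sum: "sum c UNIV = c j + sum c (UNIV - {j})" for c :: "'d \<Rightarrow> nat"
    by (intro sum.remove) auto
  have n: "sum a UNIV = sum b UNIV + 1"
    unfolding sum[of a] sum[of b] by (simp add: a)
  have IH: "fact (CARD('d) + sum b UNIV - 1) * (\<integral>\<psi>. diag_monom b \<psi> \<partial>H)
     = fact (CARD('d) - 1) * (\<Prod>k\<in>UNIV. fact (b k))"
    using Suc n by simp
  have Ia: "(\<integral>\<psi>. diag_monom a \<psi> \<partial>H) = (\<integral>\<psi>. diag_monom b \<psi> * \<psi> $ j $ j \<partial>H)"
    by (subst a, intro Bochner_Integration.integral_cong refl diag_monom_Suc)
  have fact: "fact (CARD('d) + sum a UNIV - 1)
      = (of_nat (sum b UNIV + CARD('d)) * fact (CARD('d) + sum b UNIV - 1) :: complex)"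
    using fact_reduce[of "CARD('d) + sum b UNIV", where 'a = complex] by (simp add: n add.commute)
  have "fact (CARD('d) + sum a UNIV - 1) * (\<integral>\<psi>. diag_monom a \<psi> \<partial>H)
      = fact (CARD('d) + sum b UNIV - 1) *
        (of_nat (sum b UNIV + CARD('d)) * (\<integral>\<psi>. diag_monom b \<psi> * \<psi> $ j $ j \<partial>H))"
    unfolding fact Ia by (simp only: mult_ac)
  also have "\<dots> = of_nat (b j + 1) * (fact (CARD('d) - 1) * (\<Prod>k\<in>UNIV. fact (b k)))"
    unfolding integral_diag_monom_Suc using IH by (simp only: mult.left_commute)
  also have "\<dots> = fact (CARD('d) - 1) * (\<Prod>k\<in>UNIV. fact (a k))"
    unfolding prod[of a] prod[of b] by (simp add: a algebra_simps)
  finally show ?case .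
qed

lemma integral_diag_monom_entry:
  "of_nat (sum a UNIV + CARD('d)) * (\<integral>\<psi>. diag_monom a \<psi> * \<psi> $ i $ j \<partial>H)
     = (if i = j then of_nat (a i + 1) else 0) * (\<integral>\<psi>. diag_monom a \<psi> \<partial>H)"
  using integral_diag_monom_Suc[of a j] integral_diag_monom_offdiag[of i j a] by auto

text \<open>The one-factor recursion is applied twice. After absorbing the entry at \<open>i\<close>
  into the exponents, the exponent at \<open>k\<close> has grown exactly when \<open>i = k\<close>,
  whence the extra one.\<close>

lemma integral_diag_monom_diag_diag:
  "of_nat (sum a UNIV + CARD('d)) * of_nat (sum a UNIV + CARD('d) + 1)
       * (\<integral>\<psi>. diag_monom a \<psi> * (\<psi> $ i $ i * \<psi> $ k $ k) \<partial>H)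
     = of_nat (a i + 1) * of_nat (a k + 1 + (if i = k then 1 else 0)) * (\<integral>\<psi>. diag_monom a \<psi> \<partial>H)"
proof -
  define b where "b = a(i := a i + 1)"
  have "sum c UNIV = c i + sum c (UNIV - {i})" for c :: "'d \<Rightarrow> nat"
    by (intro sum.remove) auto
  from this[of a] this[of b] have n: "sum b UNIV = sum a UNIV + 1"
    by (simp add: b_def)
  have b: "diag_monom b \<psi> = diag_monom a \<psi> * \<psi> $ i $ i" for \<psi>
    unfolding b_def by (rule diag_monom_Suc)
  have 1: "of_nat (sum a UNIV + CARD('d) + 1) * (\<integral>\<psi>. diag_monom a \<psi> * (\<psi> $ i $ i * \<psi> $ k $ k) \<partial>H)
      = of_nat (a k + 1 + (if i = k then 1 else 0)) * (\<integral>\<psi>. diag_monom a \<psi> * \<psi> $ i $ i \<partial>H)"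
    using integral_diag_monom_Suc[of b k] unfolding n b by (auto simp: b_def mult.assoc add_ac)
  show ?thesis
    unfolding mult.assoc[of "of_nat (sum a UNIV + CARD('d))"] 1
      mult.left_commute[of "of_nat (sum a UNIV + CARD('d))"] integral_diag_monom_Suc
    by (simp only: mult_ac)
qed

text \<open>The first two terms are the two balanced pairings of row with column indices. When all
  four indices agree, both pairings are counted and give \<open>2 * (b i)\<^sup>2\<close>, while the
  true factor is \<open>b i * (b i + 1)\<close>; the last term subtracts the excess. Its nested
  condition makes it an equation between index pairs.\<close>

lemma integral_diag_monom_entry_entry:
  fixes a :: "'d \<Rightarrow> nat"
  defines "b \<equiv> \<lambda>k. of_nat (a k + 1)"
  shows "of_nat (sum a UNIV + CARD('d)) * of_nat (sum a UNIV + CARD('d) + 1)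
       * (\<integral>\<psi>. diag_monom a \<psi> * (\<psi> $ i $ j * \<psi> $ k $ l) \<partial>H)
     = ((if i = j then b i else 0) * (if k = l then b k else 0)
        + (if k = j \<and> l = i then b i * b j else 0)
        - (if k = i \<and> l = j then (if i = j then (b i)\<^sup>2 - b i else 0) else 0))
       * (\<integral>\<psi>. diag_monom a \<psi> \<partial>H)"
proof -
  consider "i = j" "k = l" | "i \<noteq> j" "i = l" "k = j" | "\<not> (i = j \<and> k = l)" "\<not> (i = l \<and> k = j)"
    by blast
  then show ?thesis
  proof cases
    case 1
    then show ?thesis
      unfolding 1 integral_diag_monom_diag_diag b_def by (auto simp: power2_eq_square algebra_simps)
  next
    case 2
    have *: "k = j" "l = i"
      using 2 by auto
    have eq: "(\<integral>\<psi>. diag_monom a \<psi> * (\<psi> $ i $ j * \<psi> $ j $ i) \<partial>H)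
        = (\<integral>\<psi>. diag_monom a \<psi> * (\<psi> $ i $ i * \<psi> $ j $ j) \<partial>H)"
      by (intro Bochner_Integration.integral_cong refl arg_cong2[where f = "(*)"]
          rank_one_projector_exchange) (simp add: space_H)
    show ?thesis
      unfolding * eq integral_diag_monom_diag_diag b_def using 2(1) by simp
  next
    case 3
    then show ?thesis
      by (auto simp: integral_diag_monom_unbalanced)
  qed
qed

lemma integral_diag_monom_trace:
  "of_nat (sum a UNIV + CARD('d)) * (\<integral>\<psi>. diag_monom a \<psi> * trace (A ** \<psi>) \<partial>H)
     = (\<Sum>i\<in>UNIV. A $ i $ i * of_nat (a i + 1)) * (\<integral>\<psi>. diag_monom a \<psi> \<partial>H)"
    (is "?N * _ = _ * ?M")
proof -
  let ?I = "\<lambda>p. \<integral>\<psi>. diag_monom a \<psi> * \<psi> $ snd p $ fst p \<partial>H"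
  have "(\<integral>\<psi>. diag_monom a \<psi> * trace (A ** \<psi>) \<partial>H)
      = (\<integral>\<psi>. (\<Sum>p\<in>UNIV. A $ fst p $ snd p * (diag_monom a \<psi> * \<psi> $ snd p $ fst p)) \<partial>H)"
    by (simp only: trace_mult_pairs sum_distrib_left mult_ac)
  also have "\<dots> = (\<Sum>p\<in>UNIV. A $ fst p $ snd p * ?I p)"
    by (subst Bochner_Integration.integral_sum)
       (auto intro!: bounded_measurable_integrable bounded_measurable_intros bounded_measurable_diag_monom)
  finally have "?N * (\<integral>\<psi>. diag_monom a \<psi> * trace (A ** \<psi>) \<partial>H) = (\<Sum>p\<in>UNIV. A $ fst p $ snd p * (?N * ?I p))"
    by (simp only: sum_distrib_left mult_ac)
  also have "\<dots> = (\<Sum>p\<in>UNIV. if fst p = snd p then A $ fst p $ fst p * of_nat (a (fst p) + 1) * ?M else 0)"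
    unfolding integral_diag_monom_entry by (intro sum.cong) auto
  also have "\<dots> = (\<Sum>i\<in>UNIV. A $ i $ i * of_nat (a i + 1)) * ?M"
    by (subst sum_pairs_diag) (simp only: sum_distrib_right)
  finally show ?thesis .
qed

text \<open>Summing the two pairings and the correction against the entries of \<open>A\<close>
  gives, in this order, the square of the diagonal sum, the quadratic form, and the diagonal
  correction.\<close>

lemma integral_diag_monom_trace_square:
  fixes a :: "'d \<Rightarrow> nat" and A :: "complex^'d^'d"
  defines "b \<equiv> \<lambda>k. of_nat (a k + 1)"
  shows "of_nat (sum a UNIV + CARD('d)) * of_nat (sum a UNIV + CARD('d) + 1)
       * (\<integral>\<psi>. diag_monom a \<psi> * (trace (A ** \<psi>))\<^sup>2 \<partial>H)
     = ((\<Sum>i\<in>UNIV. A $ i $ i * b i)\<^sup>2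
        + (\<Sum>i\<in>UNIV. \<Sum>j\<in>UNIV. A $ i $ j * A $ j $ i * (b i * b j))
        - (\<Sum>i\<in>UNIV. (A $ i $ i)\<^sup>2 * ((b i)\<^sup>2 - b i))) * (\<integral>\<psi>. diag_monom a \<psi> \<partial>H)"
    (is "?D * ?L = _ * ?M")
proof -
  let ?A = "\<lambda>p. A $ fst p $ snd p"
  let ?I = "\<lambda>p q. \<integral>\<psi>. diag_monom a \<psi> * (\<psi> $ snd p $ fst p * \<psi> $ snd q $ fst q) \<partial>H"
  let ?d = "\<lambda>p. if fst p = snd p then A $ fst p $ fst p * b (fst p) else 0"
  let ?e = "\<lambda>p. if fst p = snd p then (A $ fst p $ fst p)\<^sup>2 * ((b (fst p))\<^sup>2 - b (fst p)) else 0"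
  let ?f = "\<lambda>p. ?A p * A $ snd p $ fst p * (b (fst p) * b (snd p))"
  have b: "of_nat (a k + 1) = b k" for k
    by (simp add: b_def)
  have expand: "diag_monom a \<psi> * (trace (A ** \<psi>))\<^sup>2 = (\<Sum>p\<in>UNIV. \<Sum>q\<in>UNIV. ?A p * ?A q *
        (diag_monom a \<psi> * (\<psi> $ snd p $ fst p * \<psi> $ snd q $ fst q)))" for \<psi>
    unfolding trace_mult_pairs power2_eq_square sum_product unfolding sum_distrib_left
    by (intro sum.cong refl) (simp only: mult_ac)
  have int: "integrable H (\<lambda>\<psi>. ?A p * ?A q * (diag_monom a \<psi> * (\<psi> $ snd p $ fst p * \<psi> $ snd q $ fst q)))" for p q
    by (intro bounded_measurable_integrable bounded_measurable_intros bounded_measurable_diag_monom)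
  have "?L = (\<Sum>p\<in>UNIV. \<Sum>q\<in>UNIV. ?A p * ?A q * ?I p q)"
    unfolding expand by (simp only: Bochner_Integration.integral_sum Bochner_Integration.integrable_sum int
      integral_mult_right_zero)
  then have "?D * ?L = (\<Sum>p\<in>UNIV. \<Sum>q\<in>UNIV. ?D * (?A p * ?A q * ?I p q))"
    by (simp only: sum_distrib_left)
  also have "\<dots> = (\<Sum>p\<in>UNIV. \<Sum>q\<in>UNIV. ?A p * ?A q * (?D * ?I p q))"
    by (simp only: mult.left_commute)
  also have "\<dots> = (\<Sum>p\<in>UNIV. \<Sum>q\<in>UNIV. (?d p * ?d q + (if q = (snd p, fst p) then ?f p else 0)
      - (if q = p then ?e p else 0)) * ?M)"
  proof (intro sum.cong refl)
    fix p q :: "'d \<times> 'd"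
    \<comment> \<open>The entry of \<open>\<psi>\<close> paired with
      \<open>A $ fst p $ snd p\<close> has the indices in reverse, so \<open>snd\<close> plays the
      row and \<open>fst\<close> the column. The second pairing then says that \<open>q\<close> is
      \<open>p\<close> swapped, and the correction that \<open>q = p\<close>.\<close>
    let ?c = "(if snd p = fst p then b (snd p) else 0) * (if snd q = fst q then b (snd q) else 0)"
    let ?c' = "if snd q = fst p \<and> fst q = snd p then b (snd p) * b (fst p) else 0"
    let ?c'' = "if snd q = snd p \<and> fst q = fst p
      then (if snd p = fst p then (b (snd p))\<^sup>2 - b (snd p) else 0) else 0"
    have "?A p * ?A q * (?D * ?I p q) = (?A p * ?A q * ?c + ?A p * ?A q * ?c' - ?A p * ?A q * ?c'') * ?M"
      unfolding integral_diag_monom_entry_entry b by (simp only: algebra_simps)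
    moreover have "?A p * ?A q * ?c = ?d p * ?d q"
      by simp
    moreover have "?A p * ?A q * ?c' = (if q = (snd p, fst p) then ?f p else 0)"
      by (cases q) (simp add: mult.commute)
    moreover have "?A p * ?A q * ?c'' = (if q = p then ?e p else 0)"
      by (cases p; cases q) (simp add: power2_eq_square)
    ultimately show "?A p * ?A q * (?D * ?I p q) = (?d p * ?d q + (if q = (snd p, fst p) then ?f p else 0)
      - (if q = p then ?e p else 0)) * ?M"
      by (simp only:)
  qed
  also have "\<dots> = (\<Sum>p\<in>UNIV. \<Sum>q\<in>UNIV. ?d p * ?d q + (if q = (snd p, fst p) then ?f p else 0)
      - (if q = p then ?e p else 0)) * ?M"
    by (simp only: sum_distrib_right)
  also have "(\<Sum>p\<in>UNIV. \<Sum>q\<in>UNIV. ?d p * ?d q + (if q = (snd p, fst p) then ?f p else 0)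
      - (if q = p then ?e p else 0)) = (sum ?d UNIV)\<^sup>2 + sum ?f UNIV - sum ?e UNIV"
    by (rule sum_product_plus_delta)
  also have "sum ?f UNIV = (\<Sum>i\<in>UNIV. \<Sum>j\<in>UNIV. A $ i $ j * A $ j $ i * (b i * b j))"
    by (simp only: sum.cartesian_product UNIV_Times_UNIV case_prod_unfold)
  finally show ?thesis
    unfolding sum_pairs_diag[of "\<lambda>i. A $ i $ i * b i"]
      sum_pairs_diag[of "\<lambda>i. (A $ i $ i)\<^sup>2 * ((b i)\<^sup>2 - b i)"] .
qed

end

section \<open>Outcome density of the measured state\<close>

definition arrangements :: "'d \<Rightarrow> 'd \<Rightarrow> nat \<Rightarrow> nat \<Rightarrow> 'd list set" where
  "arrangements i0 i1 p q = permutations_of_multiset (replicate_mset p i0 + replicate_mset q i1)"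

lemma arrangements_iff:
  "xs \<in> arrangements i0 i1 p q \<longleftrightarrow> mset xs = replicate_mset p i0 + replicate_mset q i1"
  by (simp add: arrangements_def permutations_of_multiset_def)

lemma length_arrangements: "xs \<in> arrangements i0 i1 p q \<Longrightarrow> length xs = p + q"
  by (metis size_mset size_replicate_mset size_union arrangements_iff)

lemma finite_lists_length: "finite {xs :: 'd::finite list. length xs = n}"
  using finite_lists_length_eq[of "UNIV :: 'd set" n] by simp

text \<open>The binomial coefficient \<open>p + q\<close> over \<open>p\<close>, multiplied
  out.\<close>

lemma card_arrangements:
  assumes "i0 \<noteq> i1"
  shows "card (arrangements i0 i1 p q) * (fact p * fact q) = fact (p + q)"
proof -
  let ?M = "replicate_mset p i0 + replicate_mset q i1"
  \<comment> \<open>The set of letters lacks \<open>i0\<close> if \<open>p = 0\<close> and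
    \<open>i1\<close> if \<open>q = 0\<close>; the added factor is then
    \<open>fact 0 = 1\<close>.\<close>
  have "(\<Prod>x\<in>set_mset ?M. fact (count ?M x)) = (\<Prod>x\<in>{i0, i1}. fact (count ?M x) :: nat)"
    by (intro prod.mono_neutral_left) (auto simp: not_in_iff split: if_splits)
  also have "\<dots> = fact p * fact q"
    using assms by simp
  finally show ?thesis
    using card_permutations_of_multiset_aux[of ?M] by (simp add: arrangements_def)
qed

lemma prod_nth_arrangements:
  fixes f :: "'d \<Rightarrow> 'c::comm_monoid_mult"
  assumes "xs \<in> arrangements i0 i1 p q"
  shows "(\<Prod>i<p + q. f (xs ! i)) = f i0 ^ p * f i1 ^ q"
proof -
  have "(\<Prod>i<p + q. f (xs ! i)) = prod_list (map f xs)"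
    using length_arrangements[OF assms] by (simp add: prod.list_conv_set_nth atLeast0LessThan)
  also have "\<dots> = prod_mset (image_mset f (mset xs))"
    by (simp flip: prod_mset_prod_list)
  also have "\<dots> = f i0 ^ p * f i1 ^ q"
    using assms by (simp add: arrangements_iff)
  finally show ?thesis .
qed

text \<open>Tensors vanishing off the arrangements form a subspace. It contains every generator of
  the span, since permuting positions preserves the multiset of letters.\<close>

lemma valid_state_support:
  assumes "valid_state i0 i1 n p q \<tau>" and n: "p + q = n" and xs: "xs \<notin> arrangements i0 i1 p q"
  shows "\<tau> xs = 0"
proof -
  let ?e = "pure_tensor (replicate p (axis i0 1) @ replicate q (axis i1 1)) :: 'a tensor"
  let ?Z = "{v :: 'a tensor. \<forall>xs. xs \<notin> arrangements i0 i1 p q \<longrightarrow> v xs = 0}"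
  have e: "ys = replicate p i0 @ replicate q i1" if "?e ys \<noteq> 0" for ys
  proof (rule nth_equalityI)
    show "length ys = length (replicate p i0 @ replicate q i1)"
      using that by (auto simp: pure_tensor_def split: if_splits)
    fix i assume "i < length ys"
    then have "(replicate p (axis i0 1) @ replicate q (axis i1 1)) ! i $ ys ! i \<noteq> (0 :: complex)"
      using that by (auto simp: pure_tensor_def split: if_splits)
    then show "ys ! i = (replicate p i0 @ replicate q i1) ! i"
      using \<open>i < length ys\<close> \<open>length ys = _\<close>
      by (auto simp: nth_append axis_def split: if_splits)
  qed
  have "tensor.span {perm_op n \<pi> ?e | \<pi>. \<pi> permutes {..<n}} \<subseteq> ?Z"
  proof (rule tensor.span_minimal)
    show "tensor.subspace ?Z"
      by (auto simp: tensor.subspace_def tscale_def)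
    show "{perm_op n \<pi> ?e | \<pi>. \<pi> permutes {..<n}} \<subseteq> ?Z"
    proof safe
      fix \<pi> ys assume \<pi>: "\<pi> permutes {..<n}" and ys: "ys \<notin> arrangements i0 i1 p q"
      show "perm_op n \<pi> ?e ys = 0"
      proof (rule ccontr)
        assume "perm_op n \<pi> ?e ys \<noteq> 0"
        then have "length ys = n" "?e (permute_list \<pi> ys) \<noteq> 0"
          by (auto simp: perm_op_def split: if_splits)
        then have "permute_list \<pi> ys = replicate p i0 @ replicate q i1" "mset (permute_list \<pi> ys) = mset ys"
          using e \<pi> by (auto intro: mset_permute_list)
        then have "mset ys = replicate_mset p i0 + replicate_mset q i1"
          by simp
        with ys show False
          by (simp add: arrangements_iff)
      qed
    qed
  qed
  then show ?thesis
    using assms by (auto simp: valid_state_def)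
qed

text \<open>Two arrangements differ by a permutation of positions, under which a symmetric tensor is
  invariant.\<close>

lemma valid_state_uniform:
  assumes "valid_state i0 i1 n p q \<tau>" and "p + q = n"
    and "xs \<in> arrangements i0 i1 p q" and "ys \<in> arrangements i0 i1 p q"
  shows "\<tau> xs = \<tau> ys"
proof -
  have "mset xs = mset ys" "length ys = n"
    using assms by (auto simp: arrangements_iff length_arrangements)
  then obtain \<pi> where \<pi>: "\<pi> permutes {..<length ys}" "permute_list \<pi> ys = xs"
    by (auto elim: mset_eq_permutation)
  then have "perm_op n \<pi> \<tau> = \<tau>"
    using assms(1) \<open>length ys = n\<close> by (auto simp: valid_state_def symmetric_subspace_def)
  then have "perm_op n \<pi> \<tau> ys = \<tau> ys"
    by simp
  then show ?thesis
    using \<pi> \<open>length ys = n\<close> by (simp add: perm_op_def)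
qed

text \<open>All entries of the tensor power between arrangements equal the same number
  \<open>w\<close>, and \<open>\<tau>\<close> has a constant value \<open>t\<close> there. The
  double sum is thus the squared cardinality times \<open>w\<close> times the squared modulus of
  \<open>t\<close>, and normalization removes one cardinality.\<close>

lemma tinner_sym_effect:
  assumes \<tau>: "valid_state i0 i1 n p q \<tau>" and n: "p + q = n"
    and \<psi>: "\<psi> \<in> rank_one_projectors"
  shows "tinner n \<tau> (sym_effect n \<psi> \<tau>) =
    of_nat ((n + CARD('d) - 1) choose (CARD('d::finite) - 1)) * of_nat (card (arrangements i0 i1 p q))
      * (\<psi> $ i0 $ i0 ^ p * \<psi> $ (i1::'d) $ i1 ^ q)"
proof -
  let ?T = "arrangements i0 i1 p q" and ?\<kappa> = "of_nat ((n + CARD('d) - 1) choose (CARD('d) - 1)) :: complex"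
  define t where "t = \<tau> (replicate p i0 @ replicate q i1)"
  define w where "w = \<psi> $ i0 $ i0 ^ p * \<psi> $ i1 $ i1 ^ q"
  have t: "\<tau> xs = t" if "xs \<in> ?T" for xs
    unfolding t_def using that by (intro valid_state_uniform[OF \<tau> n]) (simp_all add: arrangements_iff)
  have sum_T: "(\<Sum>xs | length xs = n. g xs) = (\<Sum>xs\<in>?T. g xs)"
    if "\<And>xs. xs \<notin> ?T \<Longrightarrow> g xs = 0" for g :: "'d list \<Rightarrow> complex"
    using that n by (intro sum.mono_neutral_right finite_lists_length) (auto dest: length_arrangements)
  have "1 = (\<Sum>xs | length xs = n. cnj (\<tau> xs) * \<tau> xs)"
    using \<tau> by (simp add: valid_state_def tinner_def)
  also have "\<dots> = (\<Sum>xs\<in>?T. cnj (\<tau> xs) * \<tau> xs)"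
    by (rule sum_T) (simp add: valid_state_support[OF \<tau> n])
  also have "\<dots> = of_nat (card ?T) * (cnj t * t)"
    by (simp add: t)
  finally have norm: "of_nat (card ?T) * (cnj t * t) = 1" ..
  obtain c b where cb: "\<And>i j. \<psi> $ i $ j = c i * b $ j"
    using rank_one_projector_outer_product[OF \<psi>] by blast
  \<comment> \<open>The product splits into a part depending on \<open>xs\<close> and a part
    depending on \<open>ys\<close>; each depends only on the letter counts, which are
    \<open>p\<close> and \<open>q\<close>.\<close>
  have w: "(\<Prod>i<n. \<psi> $ xs ! i $ ys ! i) = w" if "xs \<in> ?T" "ys \<in> ?T" for xs ys
    using prod_nth_arrangements[OF that(1), of c] prod_nth_arrangements[OF that(2), of "\<lambda>j. b $ j"]
    by (simp add: cb prod.distrib w_def power_mult_distrib mult_ac n)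
  have power: "tensor_power n \<psi> \<tau> xs = of_nat (card ?T) * (w * t)" if "xs \<in> ?T" for xs
  proof -
    have "tensor_power n \<psi> \<tau> xs = (\<Sum>ys | length ys = n. (\<Prod>i<n. \<psi> $ xs ! i $ ys ! i) * \<tau> ys)"
      using length_arrangements[OF that] n by (simp add: tensor_power_def)
    also have "\<dots> = (\<Sum>ys\<in>?T. (\<Prod>i<n. \<psi> $ xs ! i $ ys ! i) * \<tau> ys)"
      by (rule sum_T) (simp add: valid_state_support[OF \<tau> n])
    also have "\<dots> = of_nat (card ?T) * (w * t)"
      using that by (simp add: w t)
    finally show ?thesis .
  qed
  have "tinner n \<tau> (sym_effect n \<psi> \<tau>) = (\<Sum>xs | length xs = n. cnj (\<tau> xs) * (?\<kappa> * tensor_power n \<psi> \<tau> xs))"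
    by (simp add: tinner_def sym_effect_def tscale_def)
  also have "\<dots> = (\<Sum>xs\<in>?T. cnj (\<tau> xs) * (?\<kappa> * tensor_power n \<psi> \<tau> xs))"
    by (rule sum_T) (simp add: valid_state_support[OF \<tau> n])
  also have "\<dots> = of_nat (card ?T) * (cnj t * (?\<kappa> * (of_nat (card ?T) * (w * t))))"
    by (simp add: t power)
  also have "\<dots> = (of_nat (card ?T) * (cnj t * t)) * (?\<kappa> * of_nat (card ?T) * w)"
    by (simp only: mult_ac)
  finally show ?thesis
    unfolding norm w_def by simp
qed

section \<open>Normalization and expectations of the outcome law\<close>

text \<open>The exponents for which \<open>diag_monom\<close> is the outcome density up to a
  constant.\<close>

definition occupation :: "'d \<Rightarrow> 'd \<Rightarrow> nat \<Rightarrow> nat \<Rightarrow> 'd \<Rightarrow> nat" where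
  "occupation i0 i1 p q k = (if k = i0 then p else if k = i1 then q else 0)"

lemma sum_occupation:
  fixes f :: "'d::finite \<Rightarrow> 'c::comm_semiring_1"
  assumes "i0 \<noteq> i1"
  shows "(\<Sum>k\<in>UNIV. of_nat (occupation i0 i1 p q k) * f k) = of_nat p * f i0 + of_nat q * f i1"
proof -
  have "(\<Sum>k\<in>UNIV. of_nat (occupation i0 i1 p q k) * f k)
      = (\<Sum>k\<in>{i0, i1}. of_nat (occupation i0 i1 p q k) * f k)"
    by (intro sum.mono_neutral_right) (auto simp: occupation_def)
  then show ?thesis
    using assms by (simp add: occupation_def)
qed

lemma sum_occupation_UNIV:
  fixes i0 i1 :: "'d::finite"
  assumes "i0 \<noteq> i1"
  shows "sum (occupation i0 i1 p q) UNIV = p + q"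
  using sum_occupation[OF assms, of p q "\<lambda>_. 1 :: nat"] by simp

context haar_projector
begin

lemma diag_monom_occupation:
  assumes "i0 \<noteq> i1"
  shows "diag_monom (occupation i0 i1 p q) \<psi> = \<psi> $ i0 $ i0 ^ p * \<psi> $ i1 $ i1 ^ q"
  using assms by (subst diag_monom_split[OF assms]) (simp add: occupation_def)

definition sym_norm :: "'d \<Rightarrow> 'd \<Rightarrow> nat \<Rightarrow> nat \<Rightarrow> real" where
  "sym_norm i0 i1 p q =
     real ((p + q + CARD('d) - 1) choose (CARD('d) - 1)) * real (card (arrangements i0 i1 p q))"

lemma sym_norm_nonneg: "0 \<le> sym_norm i0 i1 p q"
  by (simp add: sym_norm_def)

text \<open>The outcome law has total mass one: the Dirichlet moment cancels against the count of
  arrangements and the binomial coefficient.\<close>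

lemma sym_norm_integral:
  assumes "i0 \<noteq> i1"
  shows "of_real (sym_norm i0 i1 p q) * (\<integral>\<psi>. diag_monom (occupation i0 i1 p q) \<psi> \<partial>H) = 1"
proof -
  let ?d = "CARD('d)" and ?I = "\<integral>\<psi>. diag_monom (occupation i0 i1 p q) \<psi> \<partial>H"
  have d: "?d \<ge> 1"
    by (simp add: Suc_leI)
  have "(\<Prod>k\<in>UNIV. fact (occupation i0 i1 p q k) :: complex) = (\<Prod>k\<in>{i0, i1}. fact (occupation i0 i1 p q k))"
    by (intro prod.mono_neutral_right) (auto simp: occupation_def)
  also have "\<dots> = fact p * fact q"
    using assms by (simp add: occupation_def)
  finally have I: "fact (p + q + ?d - 1) * ?I = fact (?d - 1) * (fact p * fact q)"
    using integral_diag_monom[of "occupation i0 i1 p q"]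
    by (simp add: sum_occupation_UNIV[OF assms] add.commute)
  have choose: "fact (?d - 1) * fact (p + q) * ((p + q + ?d - 1) choose (?d - 1)) = fact (p + q + ?d - 1)"
    using binomial_fact_lemma[of "?d - 1" "p + q + ?d - 1"] d by simp
  \<comment> \<open>Multiplying by nonzero factorials clears all denominators; the common factor is
    cancelled at the end.\<close>
  have "(fact (?d - 1) * fact (p + q) * (fact p * fact q)) * (of_real (sym_norm i0 i1 p q) * ?I)
      = of_nat (fact (?d - 1) * fact (p + q) * ((p + q + ?d - 1) choose (?d - 1))) *
        of_nat (card (arrangements i0 i1 p q) * (fact p * fact q)) * ?I"
    by (simp add: sym_norm_def mult_ac)
  also have "\<dots> = fact (p + q) * (fact (p + q + ?d - 1) * ?I)"
    unfolding choose card_arrangements[OF assms] by (simp add: mult_ac)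
  also have "\<dots> = (fact (?d - 1) * fact (p + q) * (fact p * fact q)) * 1"
    unfolding I by (simp add: mult_ac)
  finally show ?thesis
    by (subst (asm) mult_left_cancel) auto
qed

text \<open>Diagonal entries of a projector are nonnegative reals, so taking \<open>Re\<close> and
  then \<open>ennreal\<close> of the Born probability loses nothing.\<close>

lemma born_sym_effect:
  assumes "valid_state i0 i1 n p q \<tau>" "p + q = n" "i0 \<noteq> i1" "\<psi> \<in> space H"
  shows "of_real (born n \<tau> (sym_effect n \<psi>))
      = of_real (sym_norm i0 i1 p q) * diag_monom (occupation i0 i1 p q) \<psi>"
    and "0 \<le> born n \<tau> (sym_effect n \<psi>)"
proof -
  have \<psi>: "\<psi> \<in> rank_one_projectors"
    using assms(4) by (simp add: space_H)
  obtain x y where xy: "\<psi> $ i0 $ i0 = of_real x" "0 \<le> x" "\<psi> $ i1 $ i1 = of_real y" "0 \<le> y"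
    using rank_one_projector_diag_nonneg[OF \<psi>] by blast
  let ?r = "sym_norm i0 i1 p q * (x ^ p * y ^ q)"
  have eq: "of_real (sym_norm i0 i1 p q) * diag_monom (occupation i0 i1 p q) \<psi> = of_real ?r"
    unfolding diag_monom_occupation[OF assms(3)] xy by simp
  have "tinner n \<tau> (sym_effect n \<psi> \<tau>) = of_real (sym_norm i0 i1 p q) * diag_monom (occupation i0 i1 p q) \<psi>"
    unfolding tinner_sym_effect[OF assms(1,2) \<psi>] diag_monom_occupation[OF assms(3)] sym_norm_def assms(2)
    by simp
  then have "tinner n \<tau> (sym_effect n \<psi> \<tau>) = of_real ?r"
    by (simp only: eq)
  then have born: "born n \<tau> (sym_effect n \<psi>) = ?r"
    by (simp add: born_def)
  show "of_real (born n \<tau> (sym_effect n \<psi>))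
      = of_real (sym_norm i0 i1 p q) * diag_monom (occupation i0 i1 p q) \<psi>"
    by (simp only: born eq)
  show "0 \<le> born n \<tau> (sym_effect n \<psi>)"
    unfolding born by (simp add: sym_norm_nonneg xy)
qed

lemma integral_sym_outcome:
  fixes f :: "complex^'d^'d \<Rightarrow> real"
  assumes "valid_state i0 i1 n p q \<tau>" "p + q = n" "i0 \<noteq> i1" and f: "f \<in> borel_measurable H"
  shows "of_real (\<integral>\<psi>. f \<psi> \<partial>sym_outcome H n \<tau>)
    = of_real (sym_norm i0 i1 p q) * (\<integral>\<psi>. diag_monom (occupation i0 i1 p q) \<psi> * of_real (f \<psi>) \<partial>H)"
proof -
  note born = born_sym_effect[OF assms(1-3)]
  have "(\<lambda>\<psi>. Re (of_real (sym_norm i0 i1 p q) * diag_monom (occupation i0 i1 p q) \<psi>)) \<in> borel_measurable H"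
    using bounded_measurableD[OF bounded_measurable_diag_monom] by measurable
  moreover have eq: "born n \<tau> (sym_effect n \<psi>) = Re (of_real (sym_norm i0 i1 p q) * diag_monom (occupation i0 i1 p q) \<psi>)"
    if "\<psi> \<in> space H" for \<psi>
    unfolding born(1)[OF that, symmetric] by simp
  ultimately have "(\<lambda>\<psi>. born n \<tau> (sym_effect n \<psi>)) \<in> borel_measurable H"
    by (subst measurable_cong[OF eq])
  then have "(\<integral>\<psi>. f \<psi> \<partial>sym_outcome H n \<tau>) = (\<integral>\<psi>. born n \<tau> (sym_effect n \<psi>) * f \<psi> \<partial>H)"
    unfolding sym_outcome_def using f born(2) by (subst integral_density) (auto intro!: AE_I2)
  then have "of_real (\<integral>\<psi>. f \<psi> \<partial>sym_outcome H n \<tau>) = (\<integral>\<psi>. complex_of_real (born n \<tau> (sym_effect n \<psi>) * f \<psi>) \<partial>H)"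
    by (simp only: integral_complex_of_real)
  also have "\<dots> = (\<integral>\<psi>. of_real (sym_norm i0 i1 p q) * (diag_monom (occupation i0 i1 p q) \<psi> * of_real (f \<psi>)) \<partial>H)"
    by (intro Bochner_Integration.integral_cong refl) (simp add: born(1) mult.assoc)
  finally show ?thesis
    by simp
qed

end

section \<open>Variance\<close>

lemma trace_mult_scaleR: "trace (A ** (r *\<^sub>R B)) = of_real r * trace (A ** B)"
  for A B :: "complex^'d^'d"
  by (simp add: trace_mult_pairs scaleR_conv_of_real[where 'a = complex] sum_distrib_left mult_ac)

text \<open>Conjugation swaps the indices of both factors, which only relabels the double sum. Hence
  the \<open>Re\<close> in the measured quantity is harmless.\<close>

lemma trace_mult_hermitian:
  fixes A B :: "complex^'d^'d"
  assumes "hermitian A" "hermitian B"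
  shows "trace (A ** B) = of_real (Re (trace (A ** B)))"
proof -
  have "cnj (trace (A ** B)) = (\<Sum>i\<in>UNIV. \<Sum>k\<in>UNIV. cnj (A $ i $ k) * cnj (B $ k $ i))"
    by (simp add: trace_def mat_mult_nth)
  also have "\<dots> = (\<Sum>i\<in>UNIV. \<Sum>k\<in>UNIV. A $ k $ i * B $ i $ k)"
    unfolding hermitian_nth[OF assms(1)] hermitian_nth[OF assms(2)] ..
  also have "\<dots> = (\<Sum>k\<in>UNIV. \<Sum>i\<in>UNIV. A $ k $ i * B $ i $ k)"
    by (rule sum.swap)
  finally have "cnj (trace (A ** B)) = trace (A ** B)"
    by (simp add: trace_def mat_mult_nth)
  then show ?thesis
    by (simp add: complex_eq_iff)
qed

lemma sum_affine_occupation: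
  fixes f :: "'d::finite \<Rightarrow> 'c::comm_semiring_1"
  assumes "i0 \<noteq> i1"
  shows "(\<Sum>k\<in>UNIV. f k * of_nat (occupation i0 i1 p q k + 1)) = sum f UNIV + (of_nat p * f i0 + of_nat q * f i1)"
  unfolding sum_occupation[OF assms, symmetric] sum.distrib[symmetric]
  by (intro sum.cong refl) (simp add: algebra_simps)

text \<open>In the product of the two weights, the constant part gives the trace, the two linear
  parts agree and give the diagonal entries of \<open>A ** A\<close>, and the product of occupations
  gives the final bracket.\<close>

lemma sum_occupation_quadratic:
  fixes A :: "complex^'d^'d"
  assumes "i0 \<noteq> i1"
  shows "(\<Sum>i\<in>UNIV. \<Sum>j\<in>UNIV. A $ i $ j * A $ j $ i *
      (of_nat (occupation i0 i1 p q i + 1) * of_nat (occupation i0 i1 p q j + 1)))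
    = trace (A ** A) + 2 * of_nat p * (A ** A) $ i0 $ i0 + 2 * of_nat q * (A ** A) $ i1 $ i1
      + ((of_nat p)\<^sup>2 * (A $ i0 $ i0)\<^sup>2 + (of_nat q)\<^sup>2 * (A $ i1 $ i1)\<^sup>2
        + 2 * of_nat p * of_nat q * (A $ i0 $ i1 * A $ i1 $ i0))"
proof -
  let ?a = "\<lambda>k. of_nat (occupation i0 i1 p q k + 1) :: complex"
  let ?r = "\<lambda>i. (A ** A) $ i $ i + (of_nat p * (A $ i $ i0 * A $ i0 $ i) + of_nat q * (A $ i $ i1 * A $ i1 $ i))"
  have row: "(\<Sum>j\<in>UNIV. A $ i $ j * A $ j $ i * ?a j) = ?r i" for i
    unfolding sum_affine_occupation[OF assms] mat_mult_nth ..
  have "(\<Sum>i\<in>UNIV. \<Sum>j\<in>UNIV. A $ i $ j * A $ j $ i * (?a i * ?a j))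
      = (\<Sum>i\<in>UNIV. ?r i * ?a i)"
    unfolding row[symmetric] sum_distrib_right by (intro sum.cong refl) (simp only: mult_ac)
  also have "\<dots> = sum ?r UNIV + (of_nat p * ?r i0 + of_nat q * ?r i1)"
    by (rule sum_affine_occupation[OF assms])
  also have "sum ?r UNIV = trace (A ** A) + (of_nat p * (A ** A) $ i0 $ i0 + of_nat q * (A ** A) $ i1 $ i1)"
    unfolding sum.distrib sum_distrib_left[symmetric] trace_def
    by (simp add: mat_mult_nth mult.commute)
  finally show ?thesis
    by (simp add: algebra_simps power2_eq_square)
qed

context haar_projector
begin

text \<open>The scale \<open>N\<close> of the estimator cancels the denominator of the first moment,
  so the mean is \<open>m\<close>. In the second moment \<open>N\<^sup>2\<close> meets the
  denominator \<open>N * (N + 1)\<close>, which leaves \<open>N / (N + 1)\<close>.\<close>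

lemma outcome_variance_eq:
  assumes \<tau>: "valid_state i0 i1 n p q \<tau>" and n: "p + q = n" and i: "i0 \<noteq> i1"
    and A: "hermitian A"
  defines "N \<equiv> complex_of_nat (n + CARD('d))" and "b \<equiv> \<lambda>k. complex_of_nat (occupation i0 i1 p q k + 1)"
  defines "m \<equiv> \<Sum>k\<in>UNIV. A $ k $ k * b k"
  shows "of_real (outcome_variance H n \<tau> A) =
    N / (N + 1) * (m\<^sup>2 + (\<Sum>i\<in>UNIV. \<Sum>j\<in>UNIV. A $ i $ j * A $ j $ i * (b i * b j))
      - (\<Sum>i\<in>UNIV. (A $ i $ i)\<^sup>2 * ((b i)\<^sup>2 - b i))) - m\<^sup>2"
proof -
  let ?S = "m\<^sup>2 + (\<Sum>i\<in>UNIV. \<Sum>j\<in>UNIV. A $ i $ j * A $ j $ i * (b i * b j))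
      - (\<Sum>i\<in>UNIV. (A $ i $ i)\<^sup>2 * ((b i)\<^sup>2 - b i))"
  define W where "W = diag_monom (occupation i0 i1 p q)"
  define K where "K = complex_of_real (sym_norm i0 i1 p q)"
  define X where "X \<psi> = Re (trace (A ** (real (CARD('d) + n) *\<^sub>R \<psi>)))" for \<psi>
  define T where "T \<psi> = trace (A ** \<psi>)" for \<psi>
  have N0: "N \<noteq> 0" "N + 1 \<noteq> 0"
    using of_nat_neq_0[of "n + CARD('d)", where 'a = complex]
    by (simp_all only: N_def of_nat_eq_0_iff of_nat_Suc add.commute) simp_all
  have T: "bounded_measurable T"
    unfolding T_def trace_mult_pairs by (intro bounded_measurable_intros)
  have W: "bounded_measurable W"
    unfolding W_def by (rule bounded_measurable_diag_monom)
  have X_eq: "X \<psi> = real (CARD('d) + n) * Re (T \<psi>)" for \<psi>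
    by (simp add: X_def T_def trace_mult_scaleR)
  have X: "X \<in> borel_measurable H"
    unfolding X_eq[abs_def] using bounded_measurableD[OF T] by measurable
  have XN: "of_real (X \<psi>) = N * T \<psi>" if "\<psi> \<in> space H" for \<psi>
    using trace_mult_hermitian[OF A rank_one_projector_hermitian, of \<psi>] that
    by (simp add: X_eq T_def space_H N_def add.commute)
  note mean = integral_sym_outcome[OF \<tau> n i, folded K_def W_def]
  have total: "K * integral\<^sup>L H W = 1"
    unfolding K_def W_def by (rule sym_norm_integral[OF i])
  have first: "N * (\<integral>\<psi>. W \<psi> * T \<psi> \<partial>H) = m * integral\<^sup>L H W"
    using integral_diag_monom_trace[of "occupation i0 i1 p q" A]
    by (simp only: sum_occupation_UNIV[OF i] n N_def W_def T_def m_def b_def)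
  have second: "N * (N + 1) * (\<integral>\<psi>. W \<psi> * (T \<psi>)\<^sup>2 \<partial>H) = ?S * integral\<^sup>L H W"
    using integral_diag_monom_trace_square[of "occupation i0 i1 p q" A]
    by (simp only: sum_occupation_UNIV[OF i] n N_def W_def T_def m_def b_def of_nat_Suc of_nat_add of_nat_1)
  have "of_real (\<integral>\<psi>. X \<psi> \<partial>sym_outcome H n \<tau>) = K * (\<integral>\<psi>. N * (W \<psi> * T \<psi>) \<partial>H)"
    unfolding mean[OF X]
    by (intro arg_cong[where f = "(*) K"] Bochner_Integration.integral_cong refl) (simp add: XN)
  also have "\<dots> = m * (K * integral\<^sup>L H W)"
    by (simp add: first)
  finally have m: "of_real (\<integral>\<psi>. X \<psi> \<partial>sym_outcome H n \<tau>) = m"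
    by (simp add: total)
  define \<mu> where "\<mu> = (\<integral>\<psi>. X \<psi> \<partial>sym_outcome H n \<tau>)"
  have "of_real (\<integral>\<psi>. (X \<psi> - \<mu>)\<^sup>2 \<partial>sym_outcome H n \<tau>) = K * (\<integral>\<psi>. W \<psi> * of_real ((X \<psi> - \<mu>)\<^sup>2) \<partial>H)"
    by (intro mean borel_measurable_power borel_measurable_diff X borel_measurable_const)
  also have "(\<integral>\<psi>. W \<psi> * of_real ((X \<psi> - \<mu>)\<^sup>2) \<partial>H)
      = (\<integral>\<psi>. N\<^sup>2 * (W \<psi> * (T \<psi>)\<^sup>2) - 2 * m * N * (W \<psi> * T \<psi>) + m\<^sup>2 * W \<psi> \<partial>H)"
    using m by (intro Bochner_Integration.integral_cong refl)
      (simp add: XN \<mu>_def power2_eq_square algebra_simps)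
  also have "\<dots> = N\<^sup>2 * (\<integral>\<psi>. W \<psi> * (T \<psi>)\<^sup>2 \<partial>H) - 2 * m * N * (\<integral>\<psi>. W \<psi> * T \<psi> \<partial>H) + m\<^sup>2 * integral\<^sup>L H W"
  proof -
    have "integrable H (\<lambda>\<psi>. W \<psi> * (T \<psi>)\<^sup>2)" "integrable H (\<lambda>\<psi>. W \<psi> * T \<psi>)" "integrable H W"
      by (intro bounded_measurable_integrable bounded_measurable_intros W T)+
    then show ?thesis by simp
  qed
  also have "K * \<dots> = N / (N + 1) * (K * (N * (N + 1) * (\<integral>\<psi>. W \<psi> * (T \<psi>)\<^sup>2 \<partial>H)))
      - 2 * m * (K * (N * (\<integral>\<psi>. W \<psi> * T \<psi> \<partial>H))) + m\<^sup>2 * (K * integral\<^sup>L H W)"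
  proof -
    have N: "N / (N + 1) * (K * (N * (N + 1) * x)) = K * (N\<^sup>2 * x)" for x
      using N0 by (simp add: power2_eq_square)
    have "K * (N\<^sup>2 * x - 2 * m * N * y + m\<^sup>2 * z)
        = N / (N + 1) * (K * (N * (N + 1) * x)) - 2 * m * (K * (N * y)) + m\<^sup>2 * (K * z)" for x y z
      unfolding N by (simp add: algebra_simps)
    then show ?thesis .
  qed
  also have "\<dots> = N / (N + 1) * (?S * (K * integral\<^sup>L H W)) - 2 * m * (m * (K * integral\<^sup>L H W)) + m\<^sup>2 * (K * integral\<^sup>L H W)"
    unfolding first second by (simp only: mult_ac)
  also have "\<dots> = N / (N + 1) * ?S - m\<^sup>2"
    unfolding total by (simp add: power2_eq_square)
  finally show ?thesis
    unfolding \<mu>_def X_def outcome_variance_def .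
qed

text \<open>Tracelessness reduces the mean to \<open>P * x + Q * y\<close>. The last term, absent
  from the formula displayed at the top, is what the diagonal correction leaves after its
  \<open>P\<^sup>2 * x\<^sup>2\<close> and \<open>Q\<^sup>2 * y\<^sup>2\<close> cancel. The squared
  modulus arises because the quadratic form contains
  \<open>A $ i0 $ i1 * A $ i1 $ i0\<close>.\<close>

lemma outcome_variance_traceless:
  assumes "valid_state i0 i1 n p q \<tau>" and n: "p + q = n" and i: "i0 \<noteq> i1"
    and A: "hermitian A" "trace A = 0"
  shows "complex_of_real (outcome_variance H n \<tau> A) =
             of_nat (n + CARD('d)) / of_nat (n + CARD('d) + 1) *
               (trace (A ** A)
                + 2 * of_nat p * (A ** A) $ i0 $ i0 + 2 * of_nat q * (A ** A) $ i1 $ i1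
                + 2 * of_nat p * of_nat q * of_real ((cmod (A $ i0 $ i1))\<^sup>2))
             - 1 / of_nat (n + CARD('d) + 1) *
               ((of_nat p)\<^sup>2 * (A $ i0 $ i0)\<^sup>2 + (of_nat q)\<^sup>2 * (A $ i1 $ i1)\<^sup>2
                + 2 * of_nat p * of_nat q * A $ i0 $ i0 * A $ i1 $ i1)
             - of_nat (n + CARD('d)) / of_nat (n + CARD('d) + 1) *
               (of_nat p * (A $ i0 $ i0)\<^sup>2 + of_nat q * (A $ i1 $ i1)\<^sup>2)"
proof -
  define N where "N = complex_of_nat (n + CARD('d))"
  define P Q where "P = complex_of_nat p" and "Q = complex_of_nat q"
  define x y c where "x = A $ i0 $ i0" and "y = A $ i1 $ i1" and "c = complex_of_real ((cmod (A $ i0 $ i1))\<^sup>2)"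
  define t where "t = trace (A ** A) + 2 * P * (A ** A) $ i0 $ i0 + 2 * Q * (A ** A) $ i1 $ i1"
  let ?b = "\<lambda>k. complex_of_nat (occupation i0 i1 p q k + 1)"
  have N1: "N + 1 \<noteq> 0"
    using of_nat_neq_0[of "n + CARD('d)", where 'a = complex]
    by (simp only: N_def of_nat_Suc add.commute not_False_eq_True)
  have mean: "(\<Sum>k\<in>UNIV. A $ k $ k * ?b k) = P * x + Q * y"
    using A(2) unfolding sum_affine_occupation[OF i] by (simp add: trace_def P_def Q_def x_def y_def)
  have c: "A $ i0 $ i1 * A $ i1 $ i0 = c"
    unfolding c_def complex_norm_square hermitian_nth[OF A(1)] ..
  have quad: "(\<Sum>i\<in>UNIV. \<Sum>j\<in>UNIV. A $ i $ j * A $ j $ i * (?b i * ?b j))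
      = t + (P\<^sup>2 * x\<^sup>2 + Q\<^sup>2 * y\<^sup>2 + 2 * P * Q * c)"
    unfolding sum_occupation_quadratic[OF i] c t_def P_def Q_def x_def y_def ..
  \<comment> \<open>With weight one more than the occupation, the square minus the weight is
    occupation times weight, so only \<open>i0\<close> and \<open>i1\<close> contribute.\<close>
  have "(\<Sum>i\<in>UNIV. (A $ i $ i)\<^sup>2 * ((?b i)\<^sup>2 - ?b i))
      = (\<Sum>i\<in>UNIV. of_nat (occupation i0 i1 p q i) * ((A $ i $ i)\<^sup>2 * ?b i))"
    by (intro sum.cong refl) (simp add: power2_eq_square algebra_simps)
  also have "\<dots> = P * (x\<^sup>2 * (P + 1)) + Q * (y\<^sup>2 * (Q + 1))"
    unfolding sum_occupation[OF i] using i by (simp add: occupation_def P_def Q_def x_def y_def add.commute)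
  finally have diag: "(\<Sum>i\<in>UNIV. (A $ i $ i)\<^sup>2 * ((?b i)\<^sup>2 - ?b i)) = P * (x\<^sup>2 * (P + 1)) + Q * (y\<^sup>2 * (Q + 1))" .
  have "complex_of_real (outcome_variance H n \<tau> A) = N / (N + 1) *
      ((P * x + Q * y)\<^sup>2 + (t + (P\<^sup>2 * x\<^sup>2 + Q\<^sup>2 * y\<^sup>2 + 2 * P * Q * c))
        - (P * (x\<^sup>2 * (P + 1)) + Q * (y\<^sup>2 * (Q + 1)))) - (P * x + Q * y)\<^sup>2"
    unfolding outcome_variance_eq[OF assms(1) n i A(1)] mean quad diag N_def ..
  also have "\<dots> = N / (N + 1) * (t + 2 * P * Q * c)
      - 1 / (N + 1) * (P\<^sup>2 * x\<^sup>2 + Q\<^sup>2 * y\<^sup>2 + 2 * P * Q * x * y)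
      - N / (N + 1) * (P * x\<^sup>2 + Q * y\<^sup>2)"
    using N1 by (simp add: divide_simps) (simp add: algebra_simps power2_eq_square)
  finally show ?thesis
    unfolding N_def P_def Q_def x_def y_def c_def t_def by (simp only: of_nat_add of_nat_1)
qed

end

section \<open>Lower bound and asymptotics\<close>

text \<open>For hermitian \<open>A\<close> the diagonal entry of the square is the squared norm of a
  row, of which two terms are kept.\<close>

lemma hermitian_square_diag_ge:
  assumes "hermitian A" and "i \<noteq> j"
  shows "(cmod (A $ i $ i))\<^sup>2 + (cmod (A $ i $ j))\<^sup>2 \<le> Re ((A ** A) $ i $ i)"
proof -
  have eq: "(A ** A) $ i $ i = of_real (\<Sum>k\<in>UNIV. (cmod (A $ i $ k))\<^sup>2)"
    unfolding of_real_sum complex_norm_square hermitian_nth[OF assms(1)] mat_mult_nth ..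
  have "(\<Sum>k\<in>{i, j}. (cmod (A $ i $ k))\<^sup>2) \<le> (\<Sum>k\<in>UNIV. (cmod (A $ i $ k))\<^sup>2)"
    by (intro sum_mono2) auto
  then show ?thesis
    unfolding eq using assms(2) by simp
qed

lemma hermitian_trace_square_nonneg:
  assumes "hermitian A"
  shows "0 \<le> Re (trace (A ** A))"
proof -
  have "(A ** A) $ i $ i = of_real (\<Sum>k\<in>UNIV. (cmod (A $ i $ k))\<^sup>2)" for i
    unfolding of_real_sum complex_norm_square hermitian_nth[OF assms(1)] mat_mult_nth ..
  then show ?thesis
    by (simp add: trace_def sum_nonneg)
qed

text \<open>The prescribed entries force both diagonal entries of \<open>A ** A\<close> to be at
  least 2, contributing \<open>4 * (P + Q)\<close>. After clearing \<open>N + 1\<close>, this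
  absorbs the negative terms \<open>(P - Q)\<^sup>2\<close> and \<open>N * (P + Q)\<close>, and
  \<open>2 * P * Q\<close> supplies the bound with constant one.\<close>

lemma (in haar_projector) outcome_variance_ge:
  assumes \<tau>: "valid_state i0 i1 n p q \<tau>" and n: "p + q = n" and i: "i0 \<noteq> i1"
    and A: "hermitian A" "trace A = 0"
    and entries: "A $ i0 $ i0 = 1" "A $ i0 $ i1 = 1" "A $ i1 $ i0 = 1" "A $ i1 $ i1 = - 1"
  shows "real p * real q \<le> outcome_variance H n \<tau> A"
proof -
  define N where "N = real (n + CARD('d))"
  define P Q where "P = real p" and "Q = real q"
  define u s0 s1 where "u = Re (trace (A ** A))" and "s0 = Re ((A ** A) $ i0 $ i0)" and "s1 = Re ((A ** A) $ i1 $ i1)"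
  define r s where "r = N / (N + 1)" and "s = 1 / (N + 1)"
  let ?V = "outcome_variance H n \<tau> A"
  have r: "complex_of_nat (n + CARD('d)) / of_nat (n + CARD('d) + 1) = of_real r"
    and s: "1 / complex_of_nat (n + CARD('d) + 1) = of_real s"
    by (simp_all add: r_def s_def N_def)
  have V: "complex_of_real ?V =
      of_real r * (trace (A ** A) + of_real (2 * P) * (A ** A) $ i0 $ i0
        + of_real (2 * Q) * (A ** A) $ i1 $ i1 + of_real (2 * P * Q))
      - of_real (s * (P - Q)\<^sup>2) - of_real (r * (P + Q))"
    unfolding outcome_variance_traceless[OF \<tau> n i A] r s entries P_def Q_def
    by (simp add: power2_eq_square algebra_simps)
  have Re_mult: "Re (complex_of_real x * z) = x * Re z" for x z
    by simp
  have V: "?V = r * (u + 2 * P * s0 + 2 * Q * s1 + 2 * P * Q)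
      - s * (P - Q)\<^sup>2 - r * (P + Q)"
    using arg_cong[OF V, of Re] unfolding u_def s0_def s1_def
    by (simp only: Re_complex_of_real Re_mult minus_complex.sel plus_complex.sel)
  have s01: "2 \<le> s0" "2 \<le> s1" and u: "0 \<le> u"
    using hermitian_square_diag_ge[OF A(1) i] hermitian_square_diag_ge[OF A(1) i[symmetric]]
      hermitian_trace_square_nonneg[OF A(1)] by (simp_all add: entries s0_def s1_def u_def)
  have "1 \<le> CARD('d)"
    by (simp add: Suc_leI)
  then have PQ: "0 \<le> P" "0 \<le> Q" and N: "P + Q \<le> N" "1 \<le> N"
    using n unfolding P_def Q_def N_def by linarith+
  have "P * 2 \<le> P * s0" "Q * 2 \<le> Q * s1"
    using PQ s01 by (auto intro: mult_left_mono)
  then have "N * (4 * (P + Q) + 2 * P * Q) \<le> N * (u + 2 * P * s0 + 2 * Q * s1 + 2 * P * Q)"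
    using u N by (intro mult_left_mono) auto
  moreover have "(P - Q)\<^sup>2 \<le> N * (P + Q)"
  proof -
    have "(P - Q)\<^sup>2 \<le> (P + Q) * (P + Q)"
      using PQ by (simp add: power2_eq_square algebra_simps)
    also have "\<dots> \<le> N * (P + Q)"
      using PQ N by (intro mult_right_mono) auto
    finally show ?thesis .
  qed
  \<comment> \<open>Half of \<open>2 * N * P * Q\<close> covers \<open>N * P * Q\<close>, and the
    other half covers \<open>P * Q\<close> because \<open>N\<close> is at least 1.\<close>
  moreover have "(N + 1) * (P * Q) \<le> N * (2 * P * Q)"
    using mult_right_mono[OF N(2), of "P * Q"] PQ by (simp add: algebra_simps)
  moreover have "0 \<le> N * (P + Q)"
    using PQ N by simp
  moreover have "N * (4 * (P + Q) + 2 * P * Q) = 4 * (N * (P + Q)) + N * (2 * P * Q)"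
    by (simp add: algebra_simps)
  ultimately have "(N + 1) * (P * Q) \<le> N * (u + 2 * P * s0 + 2 * Q * s1 + 2 * P * Q) - (P - Q)\<^sup>2 - N * (P + Q)"
    by linarith
  also have "\<dots> = (N + 1) * ?V"
  proof -
    have "r * (N + 1) = N" "s * (N + 1) = 1"
      using N(2) by (simp_all add: r_def s_def)
    moreover have "(N + 1) * (r * x - s * y - r * z) = r * (N + 1) * x - s * (N + 1) * y - r * (N + 1) * z" for x y z
      by (simp add: algebra_simps)
    ultimately show ?thesis
      unfolding V by (simp only: mult_1)
  qed
  finally show ?thesis
    using N(2) by (simp add: P_def Q_def)
qed

theorem lemma63:
  fixes H :: "(complex^'d^'d) measure"
    and A :: "complex^'d^'d"
    and i0 i1 :: "'d::finite"
  assumes "haar_projector_measure H"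
    and "i0 \<noteq> i1"
    and "hermitian A"
    and "trace A = 0"
  shows "(\<forall>p q n \<tau>. p + q = n \<longrightarrow> valid_state i0 i1 n p q \<tau> \<longrightarrow>
           complex_of_real (outcome_variance H n \<tau> A) =
             of_nat (n + CARD('d)) / of_nat (n + CARD('d) + 1) *
               (trace (A ** A)
                + 2 * of_nat p * (A ** A) $ i0 $ i0 + 2 * of_nat q * (A ** A) $ i1 $ i1
                + 2 * of_nat p * of_nat q * of_real ((cmod (A $ i0 $ i1))\<^sup>2))
             - 1 / of_nat (n + CARD('d) + 1) *
               ((of_nat p)\<^sup>2 * (A $ i0 $ i0)\<^sup>2 + (of_nat q)\<^sup>2 * (A $ i1 $ i1)\<^sup>2
                + 2 * of_nat p * of_nat q * A $ i0 $ i0 * A $ i1 $ i1)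
             - of_nat (n + CARD('d)) / of_nat (n + CARD('d) + 1) *
               (of_nat p * (A $ i0 $ i0)\<^sup>2 + of_nat q * (A $ i1 $ i1)\<^sup>2))
         \<and>
         (A $ i0 $ i0 = 1 \<and> A $ i0 $ i1 = 1 \<and> A $ i1 $ i0 = 1 \<and> A $ i1 $ i1 = -1 \<longrightarrow>
         (\<forall>p q \<tau>. (\<forall>n. p n + q n = n) \<longrightarrow>
            (\<lambda>n. real (p n)) \<in> \<Theta>(\<lambda>n. real n) \<longrightarrow>
            (\<lambda>n. real (q n)) \<in> \<Theta>(\<lambda>n. real n) \<longrightarrow>
            (\<forall>n. valid_state i0 i1 n (p n) (q n) (\<tau> n)) \<longrightarrow>
              (\<lambda>n. 1 / (real n)\<^sup>2 * outcome_variance H n (\<tau> n) A)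
                \<in> \<Omega>(\<lambda>n. real (p n) * real (q n) / (real n)\<^sup>2 * (cmod (A $ i0 $ i1))\<^sup>2) \<and>
              (\<lambda>n. real (p n) * real (q n) / (real n)\<^sup>2 * (cmod (A $ i0 $ i1))\<^sup>2)
                \<in> \<Omega>(\<lambda>_. 1 :: real)))"
proof (intro conjI allI impI)
  interpret haar_projector H
    by standard (rule assms(1))
  fix p q n \<tau>
  assume "p + q = n" and "valid_state i0 i1 n p q \<tau>"
  then show "complex_of_real (outcome_variance H n \<tau> A) =
             of_nat (n + CARD('d)) / of_nat (n + CARD('d) + 1) *
               (trace (A ** A)
                + 2 * of_nat p * (A ** A) $ i0 $ i0 + 2 * of_nat q * (A ** A) $ i1 $ i1
                + 2 * of_nat p * of_nat q * of_real ((cmod (A $ i0 $ i1))\<^sup>2))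
             - 1 / of_nat (n + CARD('d) + 1) *
               ((of_nat p)\<^sup>2 * (A $ i0 $ i0)\<^sup>2 + (of_nat q)\<^sup>2 * (A $ i1 $ i1)\<^sup>2
                + 2 * of_nat p * of_nat q * A $ i0 $ i0 * A $ i1 $ i1)
             - of_nat (n + CARD('d)) / of_nat (n + CARD('d) + 1) *
               (of_nat p * (A $ i0 $ i0)\<^sup>2 + of_nat q * (A $ i1 $ i1)\<^sup>2)"
    using outcome_variance_traceless[OF _ _ assms(2-4)] by blast
next
  interpret haar_projector H
    by standard (rule assms(1))
  fix p q :: "nat \<Rightarrow> nat" and \<tau>
  assume entries: "A $ i0 $ i0 = 1 \<and> A $ i0 $ i1 = 1 \<and> A $ i1 $ i0 = 1 \<and> A $ i1 $ i1 = - 1"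
    and n: "\<forall>n. p n + q n = n"
    and valid: "\<forall>n. valid_state i0 i1 n (p n) (q n) (\<tau> n)"
  have ge: "real (p n) * real (q n) \<le> outcome_variance H n (\<tau> n) A" for n
    using entries n valid by (intro outcome_variance_ge[OF _ _ assms(2-4)]) auto
  \<comment> \<open>At \<open>n = 0\<close> both sides are zero because division by zero yields
    zero, so the inequality holds for every \<open>n\<close>.\<close>
  have "real (p n) * real (q n) / (real n)\<^sup>2 \<le> 1 / (real n)\<^sup>2 * outcome_variance H n (\<tau> n) A" for n
    using divide_right_mono[OF ge, of "(real n)\<^sup>2"] by simp
  moreover have "norm (real (p n) * real (q n) / (real n)\<^sup>2 * (cmod (A $ i0 $ i1))\<^sup>2)
      = real (p n) * real (q n) / (real n)\<^sup>2" for n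
    using entries by simp
  ultimately have "norm (real (p n) * real (q n) / (real n)\<^sup>2 * (cmod (A $ i0 $ i1))\<^sup>2)
      \<le> norm (1 / (real n)\<^sup>2 * outcome_variance H n (\<tau> n) A)" for n
    unfolding real_norm_def by (metis abs_ge_self order_trans)
  then show "(\<lambda>n. 1 / (real n)\<^sup>2 * outcome_variance H n (\<tau> n) A)
      \<in> \<Omega>(\<lambda>n. real (p n) * real (q n) / (real n)\<^sup>2 * (cmod (A $ i0 $ i1))\<^sup>2)"
    by (intro landau_omega.bigI[of 1]) auto
next
  fix p q :: "nat \<Rightarrow> nat"
  assume entries: "A $ i0 $ i0 = 1 \<and> A $ i0 $ i1 = 1 \<and> A $ i1 $ i0 = 1 \<and> A $ i1 $ i1 = - 1"
    and p: "(\<lambda>n. real (p n)) \<in> \<Theta>(\<lambda>n. real n)"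
    and q: "(\<lambda>n. real (q n)) \<in> \<Theta>(\<lambda>n. real n)"
  have "(\<lambda>n. real (p n) * real (q n)) \<in> \<Omega>(\<lambda>n. real n * real n)"
    by (intro landau_omega.big_mult bigthetaD2 p q)
  \<comment> \<open>Dividing by the square of \<open>n\<close> requires it to be nonzero, which
    holds from \<open>n = 1\<close> on.\<close>
  then have "(\<lambda>n. real (p n) * real (q n) / (real n)\<^sup>2) \<in> \<Omega>(\<lambda>n. real n * real n / (real n)\<^sup>2)"
    by (intro landau_omega.big.divide_right) (auto intro: eventually_sequentiallyI[of 1])
  also have "(\<lambda>n. real n * real n / (real n)\<^sup>2) \<in> \<Theta>(\<lambda>_. 1)"
    by (intro bigthetaI_cong eventually_sequentiallyI[of 1]) (simp add: power2_eq_square)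
  finally show "(\<lambda>n. real (p n) * real (q n) / (real n)\<^sup>2 * (cmod (A $ i0 $ i1))\<^sup>2) \<in> \<Omega>(\<lambda>_. 1 :: real)"
    using entries by simp
qed

end
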